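(* Let $G$ be a 2-connected graph on $n$ vertices and let $C$ be a longest cycle in $G$, of length $c$, where $10\leq c\leq n-1$. If the number of edges of $G$ with at most one endpoint in $V(C)$ is more than $(\lfloor c/2\rfloor-1)(n-c)$, then either $G$ is isomorphic to a subgraph of $W_{n,\lfloor c/2\rfloor,c}$, or $c$ is odd and $G$ is isomorphic to a subgraph of a member of $\mathcal{X}_{n,c}\cup\mathcal{Y}_{n,c}$.
   Context: Graphs are simple and finite. $W_{n,k,c}$: a clique $K_{c-k+1}$ plus $n-(c-k+1)$ new vertices each joined exactly to the same $k$ vertices of the clique. For odd $c$: $G\in\mathcal{X}_{n,c}$ if $|V(G)|=n$, $V(G)=A\cup B\cup X$ (disjoint), $G[A]\cong K_{\lfloor c/2\rfloor}$, $B,X$ independent, $A$ completely joined to $B$, and there exist $a\in A,b\in B$ with $N_G(x)=\{a,b\}$ for all $x\in X$. $G\in\mathcal{Y}_{n,c}$ if $|V(G)|=n$, $V(G)=A\cup B\cup Y$ (disjoint), $G[A]\cong K_{\lfloor c/2\rfloor}$, $B$ independent, $A$ completely joined to $B$, $G[Y]$ is a star forest with at least two stars each having at least one edge, and there exist $a,b\in A$ such that for every star $S$ of $G[Y]$, the set of vertices outside $S$ adjacent to $S$ is $\{a,b\}$, and if $|V(S)|\geq 3$ then all leaves of $S$ have degree 2 in $G$ and have a common neighbor in $\{a,b\}$. *)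

theory Defs
  imports Main
begin

record 'a sgraph =
  verts :: "'a set"
  edges :: "'a set set"

definition simple_graph :: "'a sgraph \<Rightarrow> bool" where
  "simple_graph G \<longleftrightarrow> finite (verts G) \<and> (\<forall>e\<in>edges G. e \<subseteq> verts G \<and> card e = 2)"

definition nbhd :: "'a sgraph \<Rightarrow> 'a \<Rightarrow> 'a set" where
  "nbhd G v = {u \<in> verts G. {u, v} \<in> edges G}"

definition degree :: "'a sgraph \<Rightarrow> 'a \<Rightarrow> nat" where
  "degree G v = card (nbhd G v)"

definition set_nbhd :: "'a sgraph \<Rightarrow> 'a set \<Rightarrow> 'a set" where
  "set_nbhd G S = {u \<in> verts G - S. \<exists>s\<in>S. {u, s} \<in> edges G}"

definition induced :: "'a sgraph \<Rightarrow> 'a set \<Rightarrow> 'a sgraph" where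
  "induced G S = \<lparr>verts = verts G \<inter> S, edges = {e \<in> edges G. e \<subseteq> S}\<rparr>"

definition subgraph :: "'a sgraph \<Rightarrow> 'a sgraph \<Rightarrow> bool" where
  "subgraph H G \<longleftrightarrow> simple_graph H \<and> verts H \<subseteq> verts G \<and> edges H \<subseteq> edges G"

definition isomorphic :: "'a sgraph \<Rightarrow> 'b sgraph \<Rightarrow> bool" where
  "isomorphic G H \<longleftrightarrow>
     (\<exists>f. bij_betw f (verts G) (verts H) \<and>
          (\<forall>u\<in>verts G. \<forall>v\<in>verts G. {u, v} \<in> edges G \<longleftrightarrow> {f u, f v} \<in> edges H))"

definition iso_to_subgraph :: "'a sgraph \<Rightarrow> 'b sgraph \<Rightarrow> bool" where
  "iso_to_subgraph G H \<longleftrightarrow> (\<exists>H'. subgraph H' H \<and> isomorphic G H')"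

definition reachable :: "'a sgraph \<Rightarrow> 'a \<Rightarrow> 'a \<Rightarrow> bool" where
  "reachable G u v \<longleftrightarrow> (u, v) \<in> {(x, y). {x, y} \<in> edges G}\<^sup>*"

definition connected_graph :: "'a sgraph \<Rightarrow> bool" where
  "connected_graph G \<longleftrightarrow> verts G \<noteq> {} \<and> (\<forall>u\<in>verts G. \<forall>v\<in>verts G. reachable G u v)"

definition k_connected :: "nat \<Rightarrow> 'a sgraph \<Rightarrow> bool" where
  "k_connected k G \<longleftrightarrow> card (verts G) > k \<and>
     (\<forall>S. S \<subseteq> verts G \<and> card S < k \<longrightarrow> connected_graph (induced G (verts G - S)))"

definition components :: "'a sgraph \<Rightarrow> 'a set set" where
  "components G = {{v \<in> verts G. reachable G u v} | u. u \<in> verts G}"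

text \<open>A cycle is given by the list of its vertices in cyclic order, so that its length
  as a cycle is the length of the list.\<close>

definition is_cycle :: "'a sgraph \<Rightarrow> 'a list \<Rightarrow> bool" where
  "is_cycle G C \<longleftrightarrow> length C \<ge> 3 \<and> distinct C \<and> set C \<subseteq> verts G \<and>
     (\<forall>i<length C. {C ! i, C ! (Suc i mod length C)} \<in> edges G)"

definition longest_cycle :: "'a sgraph \<Rightarrow> 'a list \<Rightarrow> bool" where
  "longest_cycle G C \<longleftrightarrow> is_cycle G C \<and> (\<forall>D. is_cycle G D \<longrightarrow> length D \<le> length C)"

definition clique :: "'a sgraph \<Rightarrow> 'a set \<Rightarrow> bool" where
  "clique G A \<longleftrightarrow> (\<forall>u\<in>A. \<forall>v\<in>A. u \<noteq> v \<longrightarrow> {u, v} \<in> edges G)"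

definition independent :: "'a sgraph \<Rightarrow> 'a set \<Rightarrow> bool" where
  "independent G B \<longleftrightarrow> (\<forall>u\<in>B. \<forall>v\<in>B. {u, v} \<notin> edges G)"

definition completely_joined :: "'a sgraph \<Rightarrow> 'a set \<Rightarrow> 'a set \<Rightarrow> bool" where
  "completely_joined G A B \<longleftrightarrow> (\<forall>u\<in>A. \<forall>v\<in>B. {u, v} \<in> edges G)"

text \<open>A star may consist of its centre alone; the requirement that it has an edge is
  imposed separately.\<close>

definition is_star :: "'a sgraph \<Rightarrow> bool" where
  "is_star S \<longleftrightarrow> (\<exists>z\<in>verts S. edges S = {{z, x} | x. x \<in> verts S - {z}})"

definition star_forest :: "'a sgraph \<Rightarrow> bool" where
  "star_forest F \<longleftrightarrow> (\<forall>S\<in>components F. is_star (induced F S))"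

definition leaves :: "'a sgraph \<Rightarrow> 'a set" where
  "leaves S = {v \<in> verts S. degree S v = 1}"

text \<open>For \<open>k \<le> c - k + 1 \<le> n\<close>: the clique is \<open>{..<c - k + 1}\<close>, and the remaining vertices
  \<open>c - k + 1, \<dots>, n - 1\<close> are joined exactly to the \<open>k\<close> clique vertices in \<open>{..<k}\<close>.\<close>

definition W_graph :: "nat \<Rightarrow> nat \<Rightarrow> nat \<Rightarrow> nat sgraph" where
  "W_graph n k c = \<lparr>verts = {..<n},
     edges = {{i, j} | i j. i < j \<and> j < c - k + 1} \<union>
             {{i, j} | i j. i < k \<and> c - k + 1 \<le> j \<and> j < n}\<rparr>"

definition X_family :: "nat \<Rightarrow> nat \<Rightarrow> 'a sgraph set" where
  "X_family n c = {G. simple_graph G \<and> card (verts G) = n \<and>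
     (\<exists>A B X. verts G = A \<union> B \<union> X \<and> A \<inter> B = {} \<and> A \<inter> X = {} \<and> B \<inter> X = {} \<and>
        card A = c div 2 \<and> clique G A \<and>
        independent G B \<and> independent G X \<and> completely_joined G A B \<and>
        (\<exists>a\<in>A. \<exists>b\<in>B. \<forall>x\<in>X. nbhd G x = {a, b}))}"

definition Y_family :: "nat \<Rightarrow> nat \<Rightarrow> 'a sgraph set" where
  "Y_family n c = {G. simple_graph G \<and> card (verts G) = n \<and>
     (\<exists>A B Y. verts G = A \<union> B \<union> Y \<and> A \<inter> B = {} \<and> A \<inter> Y = {} \<and> B \<inter> Y = {} \<and>
        card A = c div 2 \<and> clique G A \<and>
        independent G B \<and> completely_joined G A B \<and>
        star_forest (induced G Y) \<and> card (components (induced G Y)) \<ge> 2 \<and>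
        (\<forall>S\<in>components (induced G Y). edges (induced G S) \<noteq> {}) \<and>
        (\<exists>a\<in>A. \<exists>b\<in>A. \<forall>S\<in>components (induced G Y).
           set_nbhd G S = {a, b} \<and>
           (card S \<ge> 3 \<longrightarrow>
              (\<forall>l\<in>leaves (induced G S). degree G l = 2) \<and>
              (\<exists>w\<in>{a, b}. \<forall>l\<in>leaves (induced G S). w \<in> nbhd G l))))}"

end

theory Submission
  imports Defs
begin

text \<open>
  Put \<open>k = \<lfloor>c/2\<rfloor>\<close> and call a set \<open>S\<close> of vertices off \<open>C\<close> dense if more than \<open>(k - 1)|S|\<close> edges lie
  inside \<open>S\<close> or between \<open>S\<close> and \<open>C\<close>. In a smallest dense set every vertex has at least \<open>k\<close>
  neighbours in \<open>S \<union> C\<close>. Take a longest path that leaves \<open>C\<close> at a vertex \<open>a\<close>, stays off \<open>C\<close> and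
  ends at some \<open>u \<in> S\<close>. If \<open>u\<close> has no neighbour on \<open>C\<close> other than \<open>a\<close>, then its \<open>k - 1\<close>
  neighbours on the path and two disjoint paths to \<open>C\<close> give an ear with \<open>k\<close> inner vertices, too
  long for a longest cycle. Otherwise, counting the gaps on \<open>C\<close> between the neighbours of \<open>u\<close>
  leaves no slack: the path is a clique and a component of \<open>S\<close>, which is not dense unless it is a
  single vertex or an edge, and an edge is excluded by counting gaps of length three. So some vertex
  \<open>v\<close> has exactly \<open>k\<close> neighbours, all of them on \<open>C\<close>.

  Let \<open>A\<close> be the neighbourhood of \<open>v\<close>. It takes every second vertex of \<open>C\<close>, up to one gap of
  length three when \<open>c\<close> is odd. Rerouting \<open>C\<close> through \<open>v\<close> shows that the vertices in the gaps of
  length two have no neighbour outside \<open>A\<close>, and that a path off \<open>A\<close> joining two vertices of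
  \<open>A\<close> has at most two inner vertices, for even \<open>c\<close> at most one. Hence \<open>G - A\<close> has no edge
  (even \<open>c\<close>), or a single edge, a single star, or several stars attached to the same two vertices of
  \<open>A\<close>; these are the three families.
\<close>

section \<open>Paths and two disjoint paths\<close>

definition adj :: "'a sgraph \<Rightarrow> 'a \<Rightarrow> 'a \<Rightarrow> bool" where
  "adj G u v \<longleftrightarrow> {u, v} \<in> edges G"

definition gpath :: "'a sgraph \<Rightarrow> 'a list \<Rightarrow> bool" where
  "gpath G p \<longleftrightarrow> p \<noteq> [] \<and> distinct p \<and> set p \<subseteq> verts G \<and> successively (adj G) p"

lemma adj_commute: "adj G u v \<longleftrightarrow> adj G v u"
  by (simp add: adj_def insert_commute)

lemma gpath_not_Nil: "gpath G p \<Longrightarrow> p \<noteq> []"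
  by (simp add: gpath_def)

lemma gpath_singleton [simp]: "gpath G [u] \<longleftrightarrow> u \<in> verts G"
  by (simp add: gpath_def)

lemma gpath_rev [simp]: "gpath G (rev p) \<longleftrightarrow> gpath G p"
proof -
  have "(\<lambda>u v. adj G v u) = adj G" by (simp add: fun_eq_iff adj_commute)
  then have "successively (\<lambda>u v. adj G v u) p = successively (adj G) p" by (rule arg_cong)
  then show ?thesis by (simp add: gpath_def)
qed

lemma gpath_append:
  assumes "p \<noteq> []" "q \<noteq> []"
  shows "gpath G (p @ q) \<longleftrightarrow> gpath G p \<and> gpath G q \<and> set p \<inter> set q = {} \<and> adj G (last p) (hd q)"
  using assms by (auto simp: gpath_def successively_append_iff)

lemma gpath_Cons:
  assumes "p \<noteq> []"
  shows "gpath G (u # p) \<longleftrightarrow> u \<in> verts G \<and> u \<notin> set p \<and> adj G u (hd p) \<and> gpath G p"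
  using gpath_append[of "[u]" p] assms by auto

lemma gpath_appendD:
  assumes "gpath G (p @ q)"
  shows "p \<noteq> [] \<Longrightarrow> gpath G p" and "q \<noteq> [] \<Longrightarrow> gpath G q"
  using assms gpath_append[of p q G] by (cases "p = []"; cases "q = []"; simp)+

lemma gpath_join:
  assumes "gpath G p" "gpath G q" "last p = hd q" "set p \<inter> set q \<subseteq> {hd q}"
  shows "gpath G (p @ tl q)" and "hd (p @ tl q) = hd p" and "last (p @ tl q) = last q"
    and "set (p @ tl q) = set p \<union> set q"
proof -
  obtain y r where q: "q = y # r" using assms(2) by (cases q) (auto simp: gpath_def)
  have p: "p \<noteq> []" "last p = y" using assms(1,3) q by (auto simp: gpath_def)
  show "gpath G (p @ tl q)"
  proof (cases "r = []")
    case False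
    then have r: "gpath G r" "y \<notin> set r" "adj G y (hd r)"
      using assms(2) q by (simp_all add: gpath_Cons)
    then have "set p \<inter> set r = {}" using assms(4) q by auto
    then show ?thesis using assms(1) p q r False by (simp add: gpath_append)
  qed (use assms(1) q in simp)
  show "hd (p @ tl q) = hd p" "last (p @ tl q) = last q" using p q by auto
  show "set (p @ tl q) = set p \<union> set q" using p q by auto
qed

lemma gpath_first_hit:
  assumes "gpath G p" "set p \<inter> F \<noteq> {}"
  obtains q x where "gpath G (q @ [x])" "hd (q @ [x]) = hd p" "x \<in> F" "set q \<inter> F = {}"
    "set (q @ [x]) \<subseteq> set p"
proof -
  obtain q x r where p: "p = (q @ [x]) @ r" and x: "x \<in> F" "\<forall>y\<in>set q. y \<notin> F"
    using assms(2) split_list_first_prop[of p "\<lambda>y. y \<in> F"] by auto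
  have "gpath G (q @ [x])" using assms(1) gpath_appendD(1) unfolding p by blast
  moreover have "hd (q @ [x]) = hd p" using p by (cases q) auto
  ultimately show thesis using that x p by auto
qed

lemma gpath_neighbour:
  assumes "gpath G p" "x \<in> set p" "length p \<ge> 2"
  obtains y where "y \<in> set p" "adj G x y"
proof -
  obtain q r where p: "p = q @ x # r" using split_list[OF assms(2)] by blast
  show thesis
  proof (cases r)
    case Nil
    then have "q \<noteq> []" using assms(3) p by auto
    then show thesis using assms(1) p Nil that[of "last q"] by (simp add: gpath_append adj_commute)
  next
    case (Cons y s)
    then show thesis using assms(1) p that[of y] by (auto simp: gpath_def successively_append_iff)
  qed
qed

locale finite_graph =
  fixes G :: "'a sgraph"
  assumes simple: "simple_graph G"
begin

lemma finite_verts: "finite (verts G)"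
  using simple by (simp add: simple_graph_def)

lemma edgeE:
  assumes "e \<in> edges G"
  obtains u v where "e = {u, v}" "adj G u v"
  using assms simple by (auto simp: simple_graph_def adj_def card_2_iff)

lemma adj_verts:
  assumes "adj G u v"
  shows "u \<in> verts G" and "v \<in> verts G" and "u \<noteq> v"
  using assms simple by (fastforce simp: adj_def simple_graph_def)+

lemma adj_irrefl [simp]: "\<not> adj G u u"
  using adj_verts(3) by blast

lemma edge_atE:
  assumes "e \<in> edges G" "u \<in> e"
  obtains w where "e = {u, w}" "adj G w u"
proof -
  obtain s t where st: "e = {s, t}" "adj G s t" using assms(1) by (rule edgeE)
  show thesis
  proof (cases "u = s")
    case True
    then show thesis using that[of t] st by (simp add: adj_commute)
  next
    case False
    then show thesis using that[of s] st assms(2) by (simp add: insert_commute)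
  qed
qed

lemma mem_nbhd_iff: "u \<in> nbhd G v \<longleftrightarrow> adj G u v"
  using adj_verts(1) by (auto simp: nbhd_def adj_def)

lemma nbhd_verts: "nbhd G v \<subseteq> verts G"
  by (auto simp: nbhd_def)

lemma finite_nbhd: "finite (nbhd G v)"
  using finite_subset[OF nbhd_verts finite_verts] .

lemma reachable_gpath:
  assumes "s \<in> verts G" "reachable G s t"
  obtains p where "gpath G p" "hd p = s" "last p = t"
proof -
  have "(s, t) \<in> {(x, y). {x, y} \<in> edges G}\<^sup>*" using assms(2) by (simp add: reachable_def)
  then have "\<exists>p. gpath G p \<and> hd p = s \<and> last p = t"
  proof (induction rule: rtrancl_induct)
    case base
    show ?case using assms(1) by (intro exI[of _ "[s]"]) simp
  next
    case (step y z)
    then obtain p where p: "gpath G p" "hd p = s" "last p = y" by blast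
    have yz: "adj G y z" using step(2) by (simp add: adj_def)
    show ?case
    proof (cases "z \<in> set p")
      case True
      then obtain q where "gpath G (q @ [z])" "hd (q @ [z]) = hd p"
        using gpath_first_hit[OF p(1), of "{z}"] by auto
      then show ?thesis using p(2) by (intro exI[of _ "q @ [z]"]) simp
    next
      case False
      then show ?thesis using p yz adj_verts(2)[OF yz] gpath_not_Nil[OF p(1)]
        by (intro exI[of _ "p @ [z]"]) (simp add: gpath_append)
    qed
  qed
  then show thesis using that by blast
qed

end

lemma gpath_inducedD:
  assumes "gpath (induced G U) p"
  shows "gpath G p" and "set p \<subseteq> U"
proof -
  have "successively (adj G) p"
    using assms by (auto simp: gpath_def induced_def adj_def intro: successively_mono)
  then show "gpath G p" "set p \<subseteq> U" using assms by (auto simp: gpath_def induced_def)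
qed

lemma simple_graph_induced: "simple_graph G \<Longrightarrow> simple_graph (induced G U)"
  by (auto simp: simple_graph_def induced_def)

definition departs :: "'a sgraph \<Rightarrow> 'a set \<Rightarrow> 'a list \<Rightarrow> bool" where
  "departs G Z p \<longleftrightarrow> gpath G p \<and> hd p \<in> Z \<and> set (tl p) \<inter> Z = {}"

lemma departs_snoc:
  assumes "departs G Z p" "adj G (last p) t" "t \<in> verts G" "t \<notin> set p" "t \<notin> Z"
  shows "departs G Z (p @ [t])" and "hd (p @ [t]) = hd p"
  using assms gpath_not_Nil[of G p] by (auto simp: departs_def gpath_append)

lemma departs_rev:
  assumes "gpath G (q @ [x])" "x \<in> Z" "set q \<inter> Z = {}"
  shows "departs G Z (rev (q @ [x]))"
  using assms gpath_rev[of G "q @ [x]"] by (simp add: departs_def del: gpath_rev)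

lemma departs_first_hit:
  assumes r: "departs G Z r" "last r \<in> Y" and disjoint: "Y \<inter> Z = {}"
  obtains q x where "departs G Z (q @ [x])" "hd q = hd r" "q \<noteq> []" "x \<in> Y" "set q \<inter> Y = {}"
    "set (q @ [x]) \<subseteq> set r"
proof -
  have path: "gpath G r" using r(1) by (simp add: departs_def)
  then have "set r \<inter> Y \<noteq> {}" using r(2) gpath_not_Nil last_in_set by blast
  from gpath_first_hit[OF path this] obtain q x where q: "gpath G (q @ [x])"
      "hd (q @ [x]) = hd r" "x \<in> Y" "set q \<inter> Y = {}" "set (q @ [x]) \<subseteq> set r"
    by metis
  have "q \<noteq> []" using q(2,3) r(1) disjoint by (auto simp: departs_def)
  moreover have "departs G Z (q @ [x])"
    using q r(1) calculation by (cases q; cases r) (auto simp: departs_def gpath_def)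
  ultimately show thesis using that q by simp
qed

lemma departs_splice:
  assumes p: "departs G Z p" "last p = w" "set p \<inter> set q = {w}"
    and r: "gpath G (r @ [x])" "x \<in> set p" "x \<noteq> w" "set r \<inter> (set p \<union> set q \<union> Z) = {}"
  obtains p' where "departs G Z p'" "hd p' = hd p" "last p' = hd (r @ [x])" "set p' \<inter> set q = {}"
proof -
  obtain p1 p2 where p12: "p = (p1 @ [x]) @ p2" using split_list[OF r(2)] by auto
  have p2: "p2 \<noteq> []" using p12 p(2) r(3) by auto
  have gp: "gpath G (p1 @ [x])" "w \<in> set p2" "w \<notin> set (p1 @ [x])"
    using p(1,2) p2 p12 gpath_append[of "p1 @ [x]" p2] by (auto simp: departs_def)
  let ?s = "rev (r @ [x])"
  have meet: "set (p1 @ [x]) \<inter> set ?s \<subseteq> {hd ?s}" using r(4) p12 by auto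
  have join: "gpath G ((p1 @ [x]) @ tl ?s)" "hd ((p1 @ [x]) @ tl ?s) = hd (p1 @ [x])"
      "last ((p1 @ [x]) @ tl ?s) = last ?s" "set ((p1 @ [x]) @ tl ?s) = set (p1 @ [x]) \<union> set ?s"
    using gpath_join[OF gp(1) _ _ meet] r(1) gpath_rev[of G "r @ [x]"] by simp_all
  show thesis
  proof (rule that)
    show "hd ((p1 @ [x]) @ tl ?s) = hd p" using p12 by (cases p1) auto
    then show "departs G Z ((p1 @ [x]) @ tl ?s)"
      using p(1) join(1) p12 r(4) by (cases p1) (auto simp: departs_def)
    show "last ((p1 @ [x]) @ tl ?s) = hd (r @ [x])" using join(3) by (simp add: last_rev)
    show "set ((p1 @ [x]) @ tl ?s) \<inter> set q = {}"
      unfolding join(4) using gp(3) p(3) p12 r(4) by auto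
  qed
qed

locale two_connected_graph = finite_graph +
  assumes two_connected: "k_connected 2 G"
begin

lemma path_avoiding:
  assumes "s \<in> verts G - {w}" "t \<in> verts G - {w}"
  obtains p where "gpath G p" "hd p = s" "last p = t" "w \<notin> set p"
proof -
  let ?H = "induced G (verts G - ({w} \<inter> verts G))"
  have "card ({w} \<inter> verts G) < 2"
    using card_mono[of "{w}" "{w} \<inter> verts G"] by simp
  then have "connected_graph ?H"
    using two_connected by (auto simp: k_connected_def)
  then have st: "s \<in> verts ?H" "reachable ?H s t"
    using assms by (auto simp: connected_graph_def induced_def)
  interpret H: finite_graph ?H
    by unfold_locales (rule simple_graph_induced[OF simple])
  obtain p where "gpath ?H p" "hd p = s" "last p = t"
    using H.reachable_gpath[OF st] by blast
  then show thesis using that[of p] gpath_inducedD[of G _ p] by blast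
qed

lemma first_hit_avoiding:
  assumes "s \<in> verts G - {w}" "F \<subseteq> verts G" "\<not> F \<subseteq> {w}"
  obtains q x where "gpath G (q @ [x])" "hd (q @ [x]) = s" "x \<in> F" "set q \<inter> F = {}"
    "w \<notin> set (q @ [x])"
proof -
  obtain t where t: "t \<in> F" "t \<noteq> w" using assms(3) by blast
  then obtain p where p: "gpath G p" "hd p = s" "last p = t" "w \<notin> set p"
    using path_avoiding[of s w t] assms(1,2) by blast
  then have "set p \<inter> F \<noteq> {}" using t(1) gpath_not_Nil[OF p(1)] last_in_set by blast
  from gpath_first_hit[OF p(1) this] obtain q x where "gpath G (q @ [x])" "hd (q @ [x]) = hd p"
      "x \<in> F"
    "set q \<inter> F = {}" "set (q @ [x]) \<subseteq> set p" by metis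
  then show thesis using that[of q x] p by blast
qed

lemma separate_common_end:
  assumes p: "departs G Z p" "last p = w" and q: "departs G Z q" "last q = w" "hd q \<noteq> hd p"
    and meet: "set p \<inter> set q = {w}" and Z: "Z \<subseteq> verts G" "w \<notin> Z"
    and t: "t \<in> verts G" "t \<noteq> w" "t \<notin> Z"
  obtains p' q' where "departs G Z p'" "departs G Z q'" "hd p' = hd p" "hd q' \<noteq> hd p"
    "set p' \<inter> set q' = {}" "{last p', last q'} = {w, t}"
proof -
  let ?F = "(set p \<union> set q \<union> Z) - {w}"
  have F: "?F \<subseteq> verts G" using p(1) q(1) Z(1) by (auto simp: departs_def gpath_def)
  have "hd p \<in> ?F" using p(1) Z(2) by (auto simp: departs_def)
  then have nF: "\<not> ?F \<subseteq> {w}" by blast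
  have tw: "t \<in> verts G - {w}" using t by simp
  obtain r x where r: "gpath G (r @ [x])" "hd (r @ [x]) = t" "x \<in> ?F" "set r \<inter> ?F = {}"
      "w \<notin> set (r @ [x])"
    by (rule first_hit_avoiding[OF tw F nF])
  have off: "set r \<inter> (set p \<union> set q \<union> Z) = {}" using r(4,5) Z(2) by auto
  consider (on_p) "x \<in> set p" | (on_q) "x \<in> set q" | (in_Z) "x \<in> Z" "x \<notin> set p" "x \<notin> set q"
    using r(3) by blast
  then show thesis
  proof cases
    case on_p
    then obtain p' where "departs G Z p'" "hd p' = hd p" "last p' = t" "set p' \<inter> set q = {}"
      using departs_splice[OF p meet r(1) on_p _ off] r(2,3) by auto
    then show thesis using that[of p' q] q by auto
  next
    case on_q
    then obtain q' where "departs G Z q'" "hd q' = hd q" "last q' = t" "set q' \<inter> set p = {}"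
      using departs_splice[of G Z q w p r x] q meet r off by (auto simp: Un_ac Int_commute)
    then show thesis using that[of p q'] p q by auto
  next
    case in_Z
    have "hd p \<in> set p" using p(1) by (simp add: departs_def gpath_def)
    then have hd: "hd (rev (r @ [x])) \<noteq> hd p" using in_Z(2) by auto
    have "set r \<inter> Z = {}" using off by auto
    then have departs: "departs G Z (rev (r @ [x]))" by (rule departs_rev[OF r(1) in_Z(1)])
    have disjoint: "set p \<inter> set (rev (r @ [x])) = {}" using off in_Z(2) by auto
    have "last (rev (r @ [x])) = t" using r(2) by (simp only: last_rev)
    then show thesis using that[OF p(1) departs refl hd disjoint] p(2) by metis
  qed
qed

lemma two_paths_to_neighbour:
  assumes zt: "departs G Z [z, t]" and Z: "z' \<in> Z" "z' \<noteq> z" "Z \<subseteq> verts G"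
  obtains q where "departs G Z q" "hd q \<noteq> z" "last q = t" "set [z, t] \<inter> set q = {t}"
proof -
  have t: "t \<in> verts G - {z}" using zt by (auto simp: departs_def gpath_Cons)
  obtain r x where r: "gpath G (r @ [x])" "hd (r @ [x]) = t" "x \<in> Z" "set r \<inter> Z = {}"
      "z \<notin> set (r @ [x])"
    using first_hit_avoiding[OF t Z(3)] Z(1,2) by blast
  let ?q = "rev (r @ [x])"
  have "t \<in> set (r @ [x])" using r(2) hd_in_set[of "r @ [x]"] by auto
  then have "set [z, t] \<inter> set ?q = {t}" using r(5) by auto
  moreover have "last ?q = t" using r(2) by (simp only: last_rev)
  moreover have "hd ?q \<noteq> z" using r(5) by auto
  ultimately show thesis using that departs_rev[OF r(1,3,4)] by blast
qed

lemma extend_disjoint_path: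
  assumes p: "departs G Z p" "last p = w" and q: "departs G Z q" "last q = t"
    and disjoint: "set p \<inter> set q = {}" and t: "adj G w t" "t \<notin> Z"
  shows "departs G Z (p @ [t])" and "hd (p @ [t]) = hd p" and "set (p @ [t]) \<inter> set q = {t}"
proof -
  have "t \<in> set q" using q last_in_set[of q] by (auto simp: departs_def gpath_def)
  moreover have "t \<in> verts G" using t(1) by (rule adj_verts(2))
  moreover have "t \<notin> set p" using disjoint calculation(1) by auto
  ultimately show "departs G Z (p @ [t])" "hd (p @ [t]) = hd p" "set (p @ [t]) \<inter> set q = {t}"
    using departs_snoc[OF p(1)] p(2) t disjoint by auto
qed

lemma two_paths_to_vertex:
  assumes "departs G Z P" "hd P = z" "length P \<ge> 2" "z' \<in> Z" "z' \<noteq> z" "Z \<subseteq> verts G"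
  shows "\<exists>p q. departs G Z p \<and> departs G Z q \<and> hd p = z \<and> hd q \<noteq> z \<and>
    last p = last P \<and> last q = last P \<and> set p \<inter> set q = {last P}"
  using assms
proof (induction P rule: rev_induct)
  case (snoc t P)
  have "P \<noteq> []" using snoc.prems(3) by auto
  then have P: "P \<noteq> []" "departs G Z P" "hd P = z"
    using snoc.prems(1,2) by (auto simp: departs_def gpath_append)
  have t: "t \<in> verts G" "t \<notin> set P" "t \<notin> Z" "adj G (last P) t"
    using snoc.prems(1) P(1) by (auto simp: departs_def gpath_append)
  show ?case
  proof (cases "length P \<ge> 2")
    case False
    then have "P @ [t] = [z, t]" using P(1,3) by (cases P) (auto simp: Suc_le_eq)
    moreover obtain q where "departs G Z q" "hd q \<noteq> z" "last q = t" "set [z, t] \<inter> set q = {t}"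
      using two_paths_to_neighbour[OF snoc.prems(1)[unfolded calculation] snoc.prems(4-6)] .
    ultimately show ?thesis using snoc.prems(1) by (intro exI[of _ "[z, t]"] exI[of _ q]) simp
  next
    case True
    then obtain p q where pq: "departs G Z p" "departs G Z q" "hd p = z" "hd q \<noteq> z"
        "last p = last P" "last q = last P" "set p \<inter> set q = {last P}"
      using snoc.IH[OF P(2,3) True] snoc.prems by blast
    have "last P \<in> set (tl P)" using True by (cases P) auto
    then have "last P \<notin> Z" using P(2) by (auto simp: departs_def)
    moreover have "t \<noteq> last P" using t(2) P(1) by auto
    ultimately obtain p' q' where p'q': "departs G Z p'" "departs G Z q'" "hd p' = z" "hd q' \<noteq> z"
        "set p' \<inter> set q' = {}" "{last p', last q'} = {last P, t}"
      using separate_common_end[OF pq(1,5,2,6) _ pq(7) snoc.prems(6) _ t(1) _ t(3)] pq(3,4) by metis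
    consider (extend_p) "last p' = last P" "last q' = t" | (extend_q) "last q' = last P"
        "last p' = t"
      using p'q'(6) by (auto simp: doubleton_eq_iff)
    then show ?thesis
    proof cases
      case extend_p
      then show ?thesis using extend_disjoint_path[OF p'q'(1) _ p'q'(2) _ p'q'(5) t(4,3)] p'q'
        by (intro exI[of _ "p' @ [t]"] exI[of _ q']) simp
    next
      case extend_q
      then show ?thesis
        using extend_disjoint_path[OF p'q'(2) _ p'q'(1) _ _ t(4,3)] p'q'
        by (intro exI[of _ p'] exI[of _ "q' @ [t]"]) (simp add: Int_commute)
    qed
  qed
qed simp

lemma two_disjoint_paths:
  assumes P: "departs G Z P" "last P \<in> Y" and Z: "z \<in> Z" "z \<noteq> hd P" "Z \<subseteq> verts G"
    and Y: "Y \<subseteq> verts G" "Y \<inter> Z = {}" "\<not> Y \<subseteq> {last P}"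
  obtains p s q t where "departs G Z (p @ [s])" "hd p = hd P" "p \<noteq> []" "s \<in> Y" "set p \<inter> Y = {}"
    and "departs G Z (q @ [t])" "hd q \<noteq> hd P" "q \<noteq> []" "t \<in> Y" "set q \<inter> Y = {}"
    and "set (p @ [s]) \<inter> set (q @ [t]) = {}"
proof -
  have "length P \<ge> 2" using P Y(2) by (cases P; cases "tl P") (auto simp: departs_def gpath_def)
  then obtain p0 q0 where meet: "departs G Z p0" "departs G Z q0" "hd p0 = hd P" "hd q0 \<noteq> hd P"
      "last p0 = last P" "last q0 = last P" "set p0 \<inter> set q0 = {last P}"
    using two_paths_to_vertex[OF P(1) refl _ Z] by blast
  obtain t where t: "t \<in> Y" "t \<noteq> last P" using Y(3) by blast
  obtain p1 q1 where apart: "departs G Z p1" "departs G Z q1" "hd p1 = hd P" "hd q1 \<noteq> hd P"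
      "set p1 \<inter> set q1 = {}" "{last p1, last q1} = {last P, t}"
    using separate_common_end[OF meet(1,5,2,6) _ meet(7) Z(3), of t] meet(3,4) P(2) Y(1,2) t
    by (metis disjoint_iff subsetD)
  have "last p1 \<in> Y" "last q1 \<in> Y" using apart(6) t(1) P(2) by (auto simp: doubleton_eq_iff)
  then obtain p s q t where
      p: "departs G Z (p @ [s])" "hd p = hd p1" "p \<noteq> []" "s \<in> Y" "set p \<inter> Y = {}"
        "set (p @ [s]) \<subseteq> set p1"
      and q: "departs G Z (q @ [t])" "hd q = hd q1" "q \<noteq> []" "t \<in> Y" "set q \<inter> Y = {}"
        "set (q @ [t]) \<subseteq> set q1"
    using departs_first_hit[OF apart(1) _ Y(2)] departs_first_hit[OF apart(2) _ Y(2)] by metis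
  moreover have "set (p @ [s]) \<inter> set (q @ [t]) = {}" using p(6) q(6) apart(5) by auto
  ultimately show thesis using that[of p s q t] apart(3,4) by simp
qed

end

section \<open>Ears and detours of a longest cycle\<close>

lemma is_cycle_iff:
  "is_cycle G L \<longleftrightarrow> 3 \<le> length L \<and> gpath G L \<and> adj G (last L) (hd L)"
proof (cases "3 \<le> length L")
  case True
  define m where "m = length L - 1"
  have len: "length L = Suc m" and m: "m > 0" using True by (auto simp: m_def)
  have "(\<forall>i<Suc m. {L ! i, L ! (Suc i mod Suc m)} \<in> edges G) \<longleftrightarrow>
      adj G (L ! m) (L ! 0) \<and> (\<forall>i<m. adj G (L ! i) (L ! Suc i))"
    unfolding All_less_Suc by (simp add: adj_def)
  moreover have "L \<noteq> []" using len by auto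
  moreover from this have "last L = L ! m" "hd L = L ! 0"
    using len by (simp_all add: last_conv_nth hd_conv_nth)
  ultimately show ?thesis
    using True len by (auto simp: is_cycle_def gpath_def successively_conv_nth)
qed (simp add: is_cycle_def)

lemma longest_cycle_rotate:
  assumes "longest_cycle G (xs @ ys)"
  shows "longest_cycle G (ys @ xs)"
proof (cases "xs = [] \<or> ys = []")
  case False
  then show ?thesis using assms by (auto simp: longest_cycle_def is_cycle_iff gpath_append)
qed (use assms in auto)

lemma longest_cycle_rev: "longest_cycle G L \<Longrightarrow> longest_cycle G (rev L)"
  by (auto simp: longest_cycle_def is_cycle_iff hd_rev last_rev adj_commute)

lemma is_cycle_append:
  assumes "gpath G L" "gpath G (last L # D @ [hd L])" "set D \<inter> set L = {}" "3 \<le> length (L @ D)"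
  shows "is_cycle G (L @ D)"
proof (cases "D = []")
  case True
  then show ?thesis using assms by (simp add: is_cycle_iff gpath_Cons)
next
  case False
  then show ?thesis using assms gpath_not_Nil[OF assms(1)]
    by (auto simp: is_cycle_iff gpath_Cons gpath_append)
qed

lemma longest_cycle_detour:
  assumes "longest_cycle G (xs @ os)" "xs \<noteq> []" "gpath G (last xs # D @ [hd xs])"
    "set D \<inter> set xs = {}"
  shows "length D \<le> length os"
proof (rule ccontr)
  assume longer: "\<not> length D \<le> length os"
  have cycle: "is_cycle G (xs @ os)" using assms(1) by (simp add: longest_cycle_def)
  then have "gpath G xs" using assms(2) gpath_appendD(1) by (auto simp: is_cycle_iff)
  moreover have "3 \<le> length (xs @ D)" using cycle longer by (simp add: is_cycle_iff)
  ultimately have "is_cycle G (xs @ D)" using is_cycle_append assms(3,4) by blast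
  then have "length (xs @ D) \<le> length (xs @ os)" using assms(1) unfolding longest_cycle_def by blast
  then show False using longer by simp
qed

lemma longest_cycle_reroute:
  assumes longest: "longest_cycle G (xs @ os @ ys @ ps)" and ne: "xs \<noteq> []" "ys \<noteq> []"
    and v: "v \<in> verts G" "v \<notin> set xs \<union> set ys" "adj G v (last xs)" "adj G v (last ys)"
    and D: "gpath G (hd xs # D @ [hd ys])" "set D \<inter> insert v (set xs \<union> set ys) = {}"
  shows "length D + 1 \<le> length os + length ps"
proof -
  have path: "gpath G (xs @ os @ ys @ ps)"
    using longest by (simp add: longest_cycle_def is_cycle_iff)
  have "gpath G (os @ ys @ ps)" using gpath_appendD(2)[OF path] ne(2) by simp
  then have "gpath G (ys @ ps)" using gpath_appendD(2) ne(2) by blast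
  then have "gpath G xs" "gpath G ys" using gpath_appendD(1) path ne by blast+
  moreover have "set xs \<inter> set ys = {}" using path by (auto simp: gpath_def)
  ultimately have "gpath G (ys @ [v] @ rev xs)"
    using ne v by (auto simp: gpath_append gpath_Cons hd_rev adj_commute)
  moreover have "hd (ys @ [v] @ rev xs) = hd ys" "last (ys @ [v] @ rev xs) = hd xs"
    using ne by (simp_all add: last_rev)
  moreover have "length xs > 0" "length ys > 0" using ne by auto
  then have "3 \<le> length ((ys @ [v] @ rev xs) @ D)"
    unfolding length_append length_rev list.size by linarith
  moreover have "set D \<inter> set (ys @ [v] @ rev xs) = {}" using D(2) by auto
  ultimately have "is_cycle G ((ys @ [v] @ rev xs) @ D)" using is_cycle_append D(1) by metis
  then have "length ((ys @ [v] @ rev xs) @ D) \<le> length (xs @ os @ ys @ ps)"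
    using longest unfolding longest_cycle_def by blast
  then show ?thesis by simp
qed

lemma card_spaced_le:
  fixes I :: "nat set"
  assumes "I \<subseteq> {lo..hi}" "d > 0" "\<And>i j. i \<in> I \<Longrightarrow> j \<in> I \<Longrightarrow> i < j \<Longrightarrow> i + d \<le> j"
  shows "d * (card I - 1) \<le> hi - lo"
proof -
  let ?f = "\<lambda>i. (i - lo) div d"
  have "?f i < ?f j" if "i \<in> I" "j \<in> I" "i < j" for i j
  proof -
    have "lo \<le> i" "i + d \<le> j" using assms(1,3) that by auto
    then have "(i - lo) + d \<le> j - lo" by linarith
    then have "((i - lo) + d) div d \<le> ?f j" by (rule div_le_mono)
    then show ?thesis using assms(2) by (simp add: div_add_self2)
  qed
  then have "inj_on ?f I" by (intro linorder_inj_onI) (auto dest: less_imp_neq)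
  moreover have "?f ` I \<subseteq> {..(hi - lo) div d}"
    using assms(1) by (auto intro!: div_le_mono diff_le_mono)
  ultimately have "card I \<le> card {..(hi - lo) div d}" by (rule card_inj_on_le) simp
  then have "d * (card I - 1) \<le> d * ((hi - lo) div d)" by (intro mult_le_mono2) simp
  also have "\<dots> \<le> hi - lo" by simp
  finally show ?thesis .
qed

locale longest_cycle_graph = two_connected_graph +
  fixes C :: "'a list"
  assumes longest: "longest_cycle G C"
begin

lemma length_C: "length C \<ge> 3" and gpath_C: "gpath G C"
  using longest by (auto simp: longest_cycle_def is_cycle_iff)

lemma distinct_C: "distinct C" and C_verts: "set C \<subseteq> verts G"
  using gpath_C by (auto simp: gpath_def)

definition cyc :: "nat \<Rightarrow> 'a" where
  "cyc i = C ! (i mod length C)"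

definition arc :: "nat \<Rightarrow> nat \<Rightarrow> 'a list" where
  "arc i j = map cyc [i..<j]"

lemma cyc_nth: "i < length C \<Longrightarrow> cyc i = C ! i"
  by (simp add: cyc_def)

lemma cyc_add_length [simp]:
  "cyc (i + length C) = cyc i" "cyc (length C + i) = cyc i" "cyc (length C) = cyc 0"
  by (simp_all add: cyc_def)

lemma cyc_in_C: "cyc i \<in> set C"
  using length_C by (auto simp: cyc_def intro!: nth_mem mod_less_divisor)

lemma C_not_subset_singleton: "\<not> set C \<subseteq> {w}"
proof
  assume "set C \<subseteq> {w}"
  then have "card (set C) \<le> 1" using card_mono[of "{w}" "set C"] by simp
  then show False using length_C distinct_card[OF distinct_C] by simp
qed

lemma set_arc [simp]: "set (arc i j) = cyc ` {i..<j}"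
  and length_arc [simp]: "length (arc i j) = j - i"
  and arc_eq_Nil_iff [simp]: "arc i j = [] \<longleftrightarrow> j \<le> i"
  by (auto simp: arc_def)

lemma hd_arc: "i < j \<Longrightarrow> hd (arc i j) = cyc i"
  and last_arc: "i < j \<Longrightarrow> last (arc i j) = cyc (j - 1)"
  by (simp_all add: arc_def hd_map last_map)

lemma arc_append: "i \<le> j \<Longrightarrow> j \<le> l \<Longrightarrow> arc i j @ arc j l = arc i l"
  unfolding arc_def by (metis map_append le_iff_add upt_add_eq_append)

lemma longest_arc: "longest_cycle G (arc i (i + length C))"
proof (induction i)
  case 0
  have "arc 0 (length C) = C" by (rule nth_equalityI) (simp_all add: arc_def cyc_nth)
  then show ?case using longest by simp
next
  case (Suc i)
  have "i < i + length C" using length_C by linarith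
  then have "arc i (i + length C) = [cyc i] @ arc (Suc i) (i + length C)"
    by (simp add: arc_def upt_conv_Cons)
  moreover have "arc (Suc i) (Suc i + length C) = arc (Suc i) (i + length C) @ [cyc i]"
    using length_C by (simp add: arc_def)
  ultimately show ?case using Suc longest_cycle_rotate by metis
qed

lemma inj_on_cyc: "inj_on cyc {i..<i + length C}"
proof -
  have "distinct (arc i (i + length C))"
    using longest_arc by (auto simp: longest_cycle_def is_cycle_def)
  then show ?thesis by (simp add: arc_def distinct_map)
qed

lemma cyc_image: "cyc ` {i..<i + length C} = set C"
proof (rule card_subset_eq)
  show "card (cyc ` {i..<i + length C}) = card (set C)"
    using card_image[OF inj_on_cyc] distinct_card[OF distinct_C] by simp
qed (use cyc_in_C in auto)

lemma bij_betw_positions: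
  assumes "T \<subseteq> set C"
  shows "bij_betw (\<lambda>i. cyc (p + i)) {i. i < length C \<and> cyc (p + i) \<in> T} T"
  unfolding bij_betw_def
proof
  show "inj_on (\<lambda>i. cyc (p + i)) {i. i < length C \<and> cyc (p + i) \<in> T}"
  proof (rule inj_onI)
    fix i j assume "i \<in> {i. i < length C \<and> cyc (p + i) \<in> T}"
      "j \<in> {i. i < length C \<and> cyc (p + i) \<in> T}" "cyc (p + i) = cyc (p + j)"
    then have "p + i = p + j" using inj_onD[OF inj_on_cyc[of p], of "p + i" "p + j"] by auto
    then show "i = j" by simp
  qed
  show "(\<lambda>i. cyc (p + i)) ` {i. i < length C \<and> cyc (p + i) \<in> T} = T"
  proof (intro equalityI subsetI)
    fix b assume b: "b \<in> T"
    then obtain j where "j \<in> {p..<p + length C}" "b = cyc j" using assms cyc_image[of p] by blast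
    then show "b \<in> (\<lambda>i. cyc (p + i)) ` {i. i < length C \<and> cyc (p + i) \<in> T}"
      using b by (intro image_eqI[of _ _ "j - p"]) auto
  qed auto
qed

lemma set_C_cases:
  assumes "b \<in> set C"
  obtains j where "j < length C" "b = cyc j"
  using assms cyc_image[of 0] by force

text \<open>The new cycle misses the vertices strictly between \<open>i'\<close> and \<open>i\<close> and between \<open>j'\<close> and \<open>j\<close>, but
  contains \<open>v\<close> and \<open>D\<close>. The bound is stated without subtraction.\<close>

lemma reroute_predecessors:
  assumes v: "v \<in> verts G" "v \<notin> set C" "adj G v (cyc i')" "adj G v (cyc j')"
    and ij: "i' < i" "i \<le> j'" "j' < j" "j \<le> i' + length C"
    and D: "gpath G (cyc i # D @ [cyc j])" "v \<notin> set D"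
      "set D \<inter> cyc ` ({i..j'} \<union> {j..i' + length C}) = {}"
  shows "length D + i' + j' + 3 \<le> i + j"
proof -
  let ?x = "arc i (Suc j')" and ?o = "arc (Suc j') j" and ?y = "arc j (Suc (i' + length C))"
    and ?p = "arc (Suc (i' + length C)) (i + length C)"
  have "?x @ ?o @ ?y @ ?p = arc i (i + length C)"
    using ij by (simp add: arc_append)
  then have "longest_cycle G (?x @ ?o @ ?y @ ?p)" using longest_arc by simp
  moreover have "set ?x \<union> set ?y = cyc ` ({i..j'} \<union> {j..i' + length C})"
    by (simp add: image_Un atLeastLessThanSuc_atLeastAtMost)
  then have "v \<notin> set ?x \<union> set ?y" "set D \<inter> insert v (set ?x \<union> set ?y) = {}"
    using v(2) cyc_in_C D(2,3) by auto
  ultimately have "length D + 1 \<le> length ?o + length ?p"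
    using ij v D(1)
    by (intro longest_cycle_reroute[of G ?x ?o ?y ?p v D]) (simp_all add: hd_arc last_arc)
  then show ?thesis using ij by simp
qed

lemma reroute_successors:
  assumes v: "v \<in> verts G" "v \<notin> set C" "adj G v (cyc i')" "adj G v (cyc j')"
    and ij: "i < i'" "i' \<le> j" "j < j'" "j' \<le> i + length C"
    and D: "gpath G (cyc i # D @ [cyc j])" "v \<notin> set D"
      "set D \<inter> cyc ` ({i'..j} \<union> {j'..i + length C}) = {}"
  shows "length D + i + j + 3 \<le> i' + j'"
proof -
  let ?x = "rev (arc j' (Suc (i + length C)))" and ?o = "rev (arc (Suc j) j')"
    and ?y = "rev (arc i' (Suc j))" and ?p = "rev (arc (Suc i) i')"
  have "?x @ ?o @ ?y @ ?p = rev (arc (Suc i) (Suc i + length C))"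
    using ij unfolding rev_append[symmetric] by (simp add: arc_append)
  then have "longest_cycle G (?x @ ?o @ ?y @ ?p)"
    using longest_cycle_rev[OF longest_arc[of "Suc i"]] by simp
  moreover have "set ?x \<union> set ?y = cyc ` ({i'..j} \<union> {j'..i + length C})"
    by (simp add: image_Un atLeastLessThanSuc_atLeastAtMost Un_commute)
  then have "v \<notin> set ?x \<union> set ?y" "set D \<inter> insert v (set ?x \<union> set ?y) = {}"
    using v(2) cyc_in_C D(2,3) by auto
  ultimately have "length D + 1 \<le> length ?o + length ?p"
    using ij v D(1)
    by (intro longest_cycle_reroute[of G ?x ?o ?y ?p v D])
      (simp_all add: hd_rev last_rev hd_arc last_arc)
  then show ?thesis using ij by simp
qed

definition ear :: "'a \<Rightarrow> 'a list \<Rightarrow> 'a \<Rightarrow> bool" where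
  "ear s D b \<longleftrightarrow> s \<in> set C \<and> b \<in> set C \<and> gpath G (s # D @ [b]) \<and> set D \<inter> set C = {}"

lemma ear_rev: "ear s D b \<Longrightarrow> ear b (rev D) s"
  using gpath_rev[of G "s # D @ [b]"] by (simp add: ear_def del: gpath_rev)

lemma ear_gap:
  assumes "ear (cyc i) D (cyc j)" "i < j" "j < i + length C"
  shows "i + length D + 1 \<le> j"
proof -
  let ?x = "arc j (Suc (i + length C))" and ?o = "arc (Suc i) j"
  have "?o @ ?x = arc (Suc i) (Suc i + length C)" using assms(2,3) by (simp add: arc_append)
  then have "longest_cycle G (?o @ ?x)" using longest_arc by metis
  then have "longest_cycle G (?x @ ?o)" by (rule longest_cycle_rotate)
  moreover have "set D \<inter> set ?x = {}" using assms(1) cyc_in_C by (auto simp: ear_def)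
  ultimately have "length D \<le> length ?o"
    using assms by (intro longest_cycle_detour[of G ?x]) (simp_all add: ear_def hd_arc last_arc)
  then show ?thesis using assms(2) by simp
qed

lemma spaced_attachments:
  assumes T: "T \<subseteq> set C - {s}" "T \<noteq> {}" and s: "s \<in> set C"
    and outer: "\<And>b. b \<in> T \<Longrightarrow> \<exists>D. length D = r \<and> ear s D b"
    and inner: "\<And>b b'. b \<in> T \<Longrightarrow> b' \<in> T \<Longrightarrow> b \<noteq> b' \<Longrightarrow> \<exists>D. length D = m \<and> ear b D b'"
  shows "2 * r + 2 + (m + 1) * (card T - 1) \<le> length C"
proof -
  obtain p where p: "s = cyc p" using s by (rule set_C_cases)
  define I where "I = {i. i < length C \<and> cyc (p + i) \<in> T}"
  have positions: "bij_betw (\<lambda>i. cyc (p + i)) I T"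
    using bij_betw_positions[of T p] T(1) by (auto simp: I_def)
  have card: "card I = card T" using positions by (rule bij_betw_same_card)
  have I: "0 < i" "i < length C" "cyc (p + i) \<in> T" if "i \<in> I" for i
    using that T(1) p by (auto simp: I_def intro!: gr0I)
  have bounds: "r + 1 \<le> i" "i + r + 1 \<le> length C" if i: "i \<in> I" for i
  proof -
    obtain D where D: "length D = r" "ear s D (cyc (p + i))" using outer I(3)[OF i] by blast
    show "r + 1 \<le> i" using ear_gap[of p D "p + i"] D p I[OF i] by simp
    show "i + r + 1 \<le> length C"
      using ear_gap[of "p + i" "rev D" "p + length C"] ear_rev[OF D(2)] D(1) p I[OF i] by simp
  qed
  have "(m + 1) * (card I - 1) \<le> (length C - r - 1) - (r + 1)"
  proof (rule card_spaced_le)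
    show "I \<subseteq> {r + 1..length C - r - 1}" using bounds by fastforce
    fix i j assume ij: "i \<in> I" "j \<in> I" "i < j"
    then have "cyc (p + i) \<noteq> cyc (p + j)"
      using inj_onD[OF bij_betw_imp_inj_on[OF positions]] by blast
    then obtain D where "length D = m" "ear (cyc (p + i)) D (cyc (p + j))"
      using inner I(3) ij(1,2) by blast
    then show "i + (m + 1) \<le> j" using ear_gap[of "p + i" D "p + j"] ij I(2) by fastforce
  qed simp
  moreover obtain i where "i \<in> I" using T(2) bij_betw_imp_surj_on[OF positions] by blast
  ultimately show ?thesis using bounds[of i] unfolding card by linarith
qed

lemma ear_length:
  assumes "ear s D b"
  shows "2 * length D + 2 \<le> length C"
proof -
  have "b \<in> set C - {s}" "s \<in> set C" using assms by (auto simp: ear_def gpath_def)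
  then show ?thesis using spaced_attachments[of "{b}" s "length D" 0] assms by auto
qed

lemma hanging_path_bound:
  assumes q: "gpath G (s # q)" "s \<in> set C" "q \<noteq> []" "set q \<inter> set C = {}"
    and T: "nbhd G (last q) \<inter> set C - {s} \<noteq> {}"
  shows "2 * length q + 2 * card (nbhd G (last q) \<inter> set C - {s}) \<le> length C"
proof -
  let ?T = "nbhd G (last q) \<inter> set C - {s}"
  have u: "last q \<in> verts G" "last q \<notin> set C"
    using q(1,4) last_in_set[OF q(3)] by (auto simp: gpath_def)
  have "2 * length q + 2 + (1 + 1) * (card ?T - 1) \<le> length C"
  proof (rule spaced_attachments[OF _ T q(2)])
    fix b assume "b \<in> ?T"
    then have "ear s q b" using q C_verts gpath_append[of "s # q" "[b]"]
      by (auto simp: ear_def mem_nbhd_iff adj_commute)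
    then show "\<exists>D. length D = length q \<and> ear s D b" by blast
  next
    fix b b' assume "b \<in> ?T" "b' \<in> ?T" "b \<noteq> b'"
    then have "ear b [last q] b'" using u C_verts
      by (auto simp: ear_def mem_nbhd_iff gpath_Cons adj_commute)
    then show "\<exists>D. length D = 1 \<and> ear b D b'" by (intro exI[of _ "[last q]"]) simp
  qed auto
  moreover have "card ?T \<ge> 1" using T by (simp add: Suc_le_eq card_gt_0_iff)
  ultimately show ?thesis by simp
qed

lemma path_to_cycle:
  assumes "u \<in> verts G" "u \<notin> set C" "u \<noteq> w"
  obtains q x where "gpath G (q @ [x])" "q \<noteq> []" "hd q = u" "x \<in> set C" "set q \<inter> set C = {}"
    "w \<notin> set (q @ [x])"
proof -
  obtain q x where q: "gpath G (q @ [x])" "hd (q @ [x]) = u" "x \<in> set C" "set q \<inter> set C = {}"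
      "w \<notin> set (q @ [x])"
    using first_hit_avoiding[of u w "set C"] assms C_verts C_not_subset_singleton by auto
  then have "q \<noteq> []" using assms(2) by auto
  then show thesis using that q by simp
qed

end

text \<open>Follow the path from \<open>x\<close> up to the last member of \<open>N\<close> before \<open>y\<close>, jump to the end of the path
  and walk back to \<open>y\<close>.\<close>

lemma gpath_through_neighbours:
  assumes path: "gpath G (x # m @ y # r)" and N: "x \<in> N" "N \<subseteq> set (x # m @ y # r)"
    and nbrs: "\<And>z. z \<in> N \<Longrightarrow> adj G z (last (y # r))"
  obtains R where "gpath G R" "hd R = x" "last R = y" "set R \<subseteq> set (x # m @ y # r)"
    "insert (last (y # r)) N \<subseteq> set R"
proof -
  have "\<exists>z\<in>set (x # m). z \<in> N" using N(1) by simp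
  then obtain n1 z n2 where last_N: "x # m = n1 @ z # n2" "z \<in> N" "\<forall>t\<in>set n2. t \<notin> N"
    using split_list_last_prop[of "x # m" "\<lambda>z. z \<in> N"] by blast
  have split: "x # m @ y # r = (n1 @ [z]) @ n2 @ (y # r)"
    using last_N(1) by (metis append.assoc append_Cons append_Nil)
  let ?R = "(n1 @ [z]) @ rev (y # r)"
  have path': "gpath G ((n1 @ [z]) @ n2 @ (y # r))" using path unfolding split .
  have "gpath G (n1 @ [z])" "gpath G (n2 @ (y # r))" using gpath_appendD[OF path'] by simp_all
  moreover have "gpath G (y # r)" using gpath_appendD(2)[of G n2 "y # r"] calculation(2) by simp
  moreover have "set (n1 @ [z]) \<inter> set (y # r) = {}" using path' by (auto simp: gpath_def)
  moreover have "hd (rev (y # r)) = last (y # r)" by (rule hd_rev)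
  ultimately have "gpath G ?R"
    using nbrs[OF last_N(2)] gpath_rev[of G "y # r"]
    by (subst gpath_append) (simp_all del: rev.simps)
  moreover have "hd ?R = x" using last_N(1) by (cases n1) simp_all
  moreover have "last ?R = y" by simp
  moreover have "set ?R \<subseteq> set (x # m @ y # r)" unfolding split by auto
  moreover have "N \<subseteq> set ?R" using N(2) last_N(3) unfolding split by auto
  moreover have "last (y # r) \<in> set ?R" using last_in_set[of "y # r"] by (auto simp del: last.simps)
  ultimately show thesis using that[of ?R] by simp
qed

context longest_cycle_graph
begin

lemma ear_through_subset:
  assumes P: "departs G Z P" "last P \<in> set C" and Z: "Z \<subseteq> verts G - set C" "z \<in> Z" "z \<noteq> hd P"
    and paths: "\<And>y. y \<in> Z \<Longrightarrow> y \<noteq> hd P \<Longrightarrow>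
      \<exists>R. gpath G R \<and> hd R = hd P \<and> last R = y \<and> set R \<subseteq> Z \<and> K \<subseteq> set R"
  obtains s D b where "ear s D b" "K \<subseteq> set D"
proof -
  have Z_off: "Z \<subseteq> verts G" "set C \<inter> Z = {}" using Z(1) by auto
  obtain p s q b where p: "departs G Z (p @ [s])" "hd p = hd P" "p \<noteq> []" "s \<in> set C"
      "set p \<inter> set C = {}"
      and q: "departs G Z (q @ [b])" "hd q \<noteq> hd P" "q \<noteq> []" "b \<in> set C" "set q \<inter> set C = {}"
      and disjoint: "set (p @ [s]) \<inter> set (q @ [b]) = {}"
    by (rule two_disjoint_paths[OF P Z(2,3) Z_off(1) C_verts Z_off(2) C_not_subset_singleton])
  have hd_q: "hd (q @ [b]) \<in> Z" "hd (q @ [b]) \<noteq> hd P" using q(1-3) by (auto simp: departs_def)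
  obtain R where R: "gpath G R" "hd R = hd P" "last R = hd (q @ [b])" "set R \<subseteq> Z" "K \<subseteq> set R"
    using paths[OF hd_q] by blast
  have only_hd: "set (w @ [t]) \<inter> Z \<subseteq> {hd w}" if "departs G Z (w @ [t])" "w \<noteq> []" for w t
    using that by (cases w) (auto simp: departs_def)
  let ?p = "rev (p @ [s])"
  have meet: "set ?p \<inter> set R \<subseteq> {hd R}" using only_hd[OF p(1,3)] p(2) R(2,4) by auto
  have "gpath G ?p" "last ?p = hd R" using p(1-3) R(2) gpath_rev[of G "p @ [s]"]
    by (simp_all add: departs_def last_rev del: rev_append)
  note pR = gpath_join[OF this(1) R(1) this(2) meet]
  have meet': "set (?p @ tl R) \<inter> set (q @ [b]) \<subseteq> {hd (q @ [b])}"
    using only_hd[OF q(1,3)] q(3) disjoint R(4) unfolding pR(4) by auto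
  have "gpath G (q @ [b])" "last (?p @ tl R) = hd (q @ [b])"
    using q(1) R(3) pR(3) by (simp_all add: departs_def)
  note W = gpath_join[OF pR(1) this meet']
  let ?D = "rev p @ tl R @ tl q"
  have W_eq: "(?p @ tl R) @ tl (q @ [b]) = s # ?D @ [b]"
    using q(3) by (cases q) simp_all
  have RC: "set R \<inter> set C = {}" using R(4) Z(1) by auto
  have "set ?D \<subseteq> set p \<union> set R \<union> set q"
    by (cases R; cases q) auto
  then have "set ?D \<inter> set C = {}" using p(5) q(5) RC by auto
  then have "ear s ?D b" using W(1) p(4) q(4) unfolding W_eq ear_def by simp
  moreover have "set R \<subseteq> insert s (insert b (set ?D))"
    using W(4) unfolding pR(4) W_eq by auto
  then have "set R \<subseteq> set ?D" using RC p(4) q(4) by auto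
  ultimately show thesis using that R(5) by blast
qed

lemma neighbours_on_hanging_path:
  assumes q: "gpath G (a # q)" "a \<in> set C" "q \<noteq> []" "set q \<inter> set C = {}"
    and N: "N \<subseteq> set q" "N \<subseteq> nbhd G (last q)" "N \<noteq> {}"
  shows "2 * card N + 4 \<le> length C"
proof -
  let ?u = "last q"
  have nbrs: "adj G z ?u" if "z \<in> N" for z using N(2) that by (auto simp: mem_nbhd_iff)
  have uN: "?u \<notin> N" using nbrs by force
  have "\<exists>x\<in>set q. x \<in> N" using N(1,3) by blast
  then obtain q1 x q2 where split: "q = q1 @ x # q2" and x: "x \<in> N" and first: "\<forall>y\<in>set q1. y \<notin> N"
    using split_list_first_prop[of q "\<lambda>x. x \<in> N"] by blast
  let ?Z = "set (x # q2)"
  have q2: "q2 \<noteq> []" using uN x split by auto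
  have last_q2: "last q2 = ?u" using q2 split by simp
  have path: "gpath G ((a # q1) @ x # q2)" using q(1) split by simp
  have NZ: "N \<subseteq> ?Z" using N(1) first split by auto
  have paths: "\<exists>R. gpath G R \<and> hd R = x \<and> last R = y \<and> set R \<subseteq> ?Z \<and> insert ?u N \<subseteq> set R"
    if y: "y \<in> ?Z" "y \<noteq> x" for y
  proof -
    obtain m r where m: "q2 = m @ y # r" using y split_list[of y q2] by auto
    have "gpath G (x # m @ y # r)" using gpath_appendD(2)[OF path] m by simp
    then show ?thesis
      using gpath_through_neighbours[of G x m y r N] x NZ nbrs last_q2 m
      by (metis last_appendR list.discI)
  qed
  have "departs G ?Z (rev ((a # q1) @ [x]))"
    using path gpath_appendD(1)[of G "(a # q1) @ [x]" q2]
    by (intro departs_rev) (auto simp: gpath_def)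
  moreover have "last (rev ((a # q1) @ [x])) \<in> set C" using q(2) by simp
  moreover have "?Z \<subseteq> verts G - set C" using q(1,4) split by (auto simp: gpath_def)
  moreover have "?u \<in> ?Z" "?u \<noteq> hd (rev ((a # q1) @ [x]))"
    using last_in_set[OF q2] last_q2 uN x by auto
  ultimately obtain s D b where D: "ear s D b" "insert ?u N \<subseteq> set D"
    using ear_through_subset[of ?Z "rev ((a # q1) @ [x])" ?u "insert ?u N"] paths by auto
  have "card (insert ?u N) \<le> length D"
    using card_mono[OF _ D(2)] card_length[of D] by simp
  then show ?thesis using ear_length[OF D(1)] uN finite_subset[OF N(1)] by simp
qed

end

section \<open>A vertex with the maximum number of neighbours on the cycle\<close>

context longest_cycle_graph
begin

lemma nbhd_subset_cycle_if_half:
  assumes v: "v \<in> verts G" "v \<notin> set C"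
    and half: "card (nbhd G v \<inter> set C) = length C div 2" "2 \<le> length C div 2"
  shows "nbhd G v \<subseteq> set C"
proof
  fix x assume x: "x \<in> nbhd G v"
  show "x \<in> set C"
  proof (rule ccontr)
    assume "x \<notin> set C"
    then obtain q s where q: "gpath G (q @ [s])" "q \<noteq> []" "hd q = x" "s \<in> set C"
        "set q \<inter> set C = {}"
        "v \<notin> set (q @ [s])"
      using path_to_cycle[of x v] x adj_verts[of x v] by (auto simp: mem_nbhd_iff)
    have "gpath G (s # rev q @ [v])"
      using q v x gpath_rev[of G "q @ [s]"] gpath_append[of "s # rev q" "[v]"]
      by (auto simp: last_rev mem_nbhd_iff)
    moreover have drop_one: "length C div 2 - 1 \<le> card (nbhd G v \<inter> set C - {s})"
      using half(1) finite_nbhd by (simp add: card_Diff_singleton_if)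
    then have "card (nbhd G v \<inter> set C - {s}) \<noteq> 0" using half(2) by linarith
    then have "nbhd G v \<inter> set C - {s} \<noteq> {}" by (metis card.empty)
    ultimately have "2 * length (rev q @ [v]) + 2 * card (nbhd G v \<inter> set C - {s}) \<le> length C"
      using hanging_path_bound[of s "rev q @ [v]"] q(4,5) v(2) by auto
    moreover have "length q \<ge> 1" using q(2) by (simp add: Suc_le_eq)
    moreover have "length C \<le> 2 * (length C div 2) + 1" by linarith
    ultimately show False using drop_one half(2) by simp
  qed
qed

definition attached_edges :: "'a set \<Rightarrow> 'a set set" where
  "attached_edges S = {e \<in> edges G. e \<subseteq> S \<union> set C \<and> e \<inter> S \<noteq> {}}"

lemma finite_attached_edges: "finite (attached_edges S)"
proof -
  have "edges G \<subseteq> Pow (verts G)" using simple by (auto simp: simple_graph_def)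
  then have "finite (edges G)" using finite_verts by (meson finite_Pow_iff finite_subset)
  then show ?thesis by (simp add: attached_edges_def)
qed

lemma edges_off_cycle_attached:
  "{e \<in> edges G. card (e \<inter> set C) \<le> 1} \<subseteq> attached_edges (verts G - set C)"
proof
  fix e assume "e \<in> {e \<in> edges G. card (e \<inter> set C) \<le> 1}"
  then have e: "e \<in> edges G" "card (e \<inter> set C) \<le> 1" by auto
  then have verts: "e \<subseteq> verts G" "card e = 2" using simple by (auto simp: simple_graph_def)
  have "\<not> e \<subseteq> set C"
    using e(2) verts(2) by (auto simp: Int_absorb2)
  then show "e \<in> attached_edges (verts G - set C)"
    using e(1) verts(1) by (auto simp: attached_edges_def)
qed

lemma card_attached_edges_insert:
  "card (attached_edges (insert u S)) \<le> card (attached_edges S) + card (nbhd G u \<inter> (S \<union> set C))"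
proof -
  let ?N = "nbhd G u \<inter> (S \<union> set C)"
  have "attached_edges (insert u S) \<subseteq> attached_edges S \<union> (\<lambda>w. {u, w}) ` ?N"
  proof
    fix e assume "e \<in> attached_edges (insert u S)"
    then have e: "e \<in> edges G" "e \<subseteq> insert u S \<union> set C" "e \<inter> insert u S \<noteq> {}"
      by (auto simp: attached_edges_def)
    show "e \<in> attached_edges S \<union> (\<lambda>w. {u, w}) ` ?N"
    proof (cases "u \<in> e")
      case True
      obtain w where w: "e = {u, w}" "adj G w u" using e(1) True by (rule edge_atE)
      then have "w \<in> ?N" using e(2) adj_verts(3)[OF w(2)] by (simp add: mem_nbhd_iff)
      then show ?thesis using w(1) by blast
    qed (use e in \<open>auto simp: attached_edges_def\<close>)
  qed
  then have "card (attached_edges (insert u S)) \<le> card (attached_edges S \<union> (\<lambda>w. {u, w}) ` ?N)"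
    using finite_attached_edges finite_nbhd by (intro card_mono) auto
  also have "\<dots> \<le> card (attached_edges S) + card ?N"
    using card_Un_le card_image_le[of ?N "\<lambda>w. {u, w}"] finite_nbhd
    by (meson add_left_mono finite_Int order_trans)
  finally show ?thesis .
qed

lemma card_attached_edges_le:
  assumes "finite Q" "\<And>u. u \<in> Q \<Longrightarrow> card (nbhd G u \<inter> set C) \<le> d"
  shows "2 * card (attached_edges Q) \<le> card Q * (card Q - 1) + 2 * d * card Q"
  using assms
proof (induction Q rule: finite_induct)
  case empty
  then show ?case by (simp add: attached_edges_def)
next
  case (insert u Q)
  have "card (nbhd G u \<inter> (Q \<union> set C)) \<le> card (nbhd G u \<inter> Q) + card (nbhd G u \<inter> set C)"
    unfolding Int_Un_distrib by (rule card_Un_le)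
  also have "\<dots> \<le> card Q + d" using insert by (intro add_mono card_mono) auto
  finally have "card (attached_edges (insert u Q)) \<le> card (attached_edges Q) + (card Q + d)"
    using card_attached_edges_insert[of u Q] by linarith
  moreover have "2 * card (attached_edges Q) \<le> card Q * (card Q - 1) + 2 * d * card Q"
    using insert by simp
  moreover have "card Q * (card Q - 1) + 2 * card Q = Suc (card Q) * card Q"
    by (cases "card Q") auto
  ultimately show ?case using insert(1,2) by (simp add: distrib_left)
qed

end

locale minimal_dense_set = longest_cycle_graph +
  fixes k :: nat and S :: "'a set"
  assumes k: "k = length C div 2" "5 \<le> k"
    and S_off_C: "S \<subseteq> verts G - set C"
    and dense: "(k - 1) * card S < card (attached_edges S)"
    and minimal: "S' \<subseteq> verts G - set C \<Longrightarrow>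
      (k - 1) * card S' < card (attached_edges S') \<Longrightarrow> card S \<le> card S'"
begin

lemma length_C_le: "length C \<le> 2 * k + 1"
  using k(1) by linarith

lemma finite_S: "finite S"
  using S_off_C finite_verts finite_subset by blast

lemma S_not_empty: "S \<noteq> {}"
  using dense by (auto simp: attached_edges_def)

lemma removal_loses_edges:
  assumes "Q \<subseteq> S" "Q \<noteq> {}"
  shows "card (attached_edges (S - Q)) + (k - 1) * card Q < card (attached_edges S)"
proof -
  have card: "card S = card Q + card (S - Q)"
    using assms(1) finite_S by (metis card_Diff_subset card_mono finite_subset le_add_diff_inverse)
  have "card Q > 0" using assms finite_S finite_subset by (auto simp: card_gt_0_iff)
  then have "\<not> card S \<le> card (S - Q)" using card by simp
  then have "card (attached_edges (S - Q)) \<le> (k - 1) * card (S - Q)"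
    using minimal[of "S - Q"] S_off_C by fastforce
  then show ?thesis using dense unfolding card by (simp add: distrib_left)
qed

lemma degree_ge:
  assumes "u \<in> S"
  shows "k \<le> card (nbhd G u \<inter> S) + card (nbhd G u \<inter> set C)"
proof -
  have "card (attached_edges S)
      \<le> card (attached_edges (S - {u})) + card (nbhd G u \<inter> ((S - {u}) \<union> set C))"
    using card_attached_edges_insert[of u "S - {u}"] assms by (simp add: insert_absorb)
  moreover have "card (nbhd G u \<inter> ((S - {u}) \<union> set C)) \<le> card (nbhd G u \<inter> S \<union> nbhd G u \<inter> set C)"
    using finite_nbhd by (intro card_mono) auto
  ultimately show ?thesis
    using removal_loses_edges[of "{u}"] assms card_Un_le[of "nbhd G u \<inter> S" "nbhd G u \<inter> set C"]
    by simp
qed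

lemma closed_subset_dense:
  assumes Q: "Q \<subseteq> S" "Q \<noteq> {}" and closed: "\<And>u. u \<in> Q \<Longrightarrow> nbhd G u \<inter> S \<subseteq> Q"
  shows "(k - 1) * card Q < card (attached_edges Q)"
proof -
  have "attached_edges S \<subseteq> attached_edges Q \<union> attached_edges (S - Q)"
  proof
    fix e assume "e \<in> attached_edges S"
    then have e: "e \<in> edges G" "e \<subseteq> S \<union> set C" "e \<inter> S \<noteq> {}" by (auto simp: attached_edges_def)
    obtain u w where uw: "e = {u, w}" "adj G u w" using e(1) by (rule edgeE)
    have "w \<in> nbhd G u" "u \<in> nbhd G w" using uw(2) by (simp_all add: mem_nbhd_iff adj_commute)
    then have "u \<in> Q \<Longrightarrow> w \<in> Q \<union> set C" "w \<in> Q \<Longrightarrow> u \<in> Q \<union> set C"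
      using closed[of u] closed[of w] e(2) uw(1) by auto
    then have "e \<subseteq> Q \<union> set C" if "e \<inter> Q \<noteq> {}" using that uw(1) by auto
    moreover have "e \<subseteq> (S - Q) \<union> set C" "e \<inter> (S - Q) \<noteq> {}" if "e \<inter> Q = {}"
      using that e(2,3) by auto
    ultimately show "e \<in> attached_edges Q \<union> attached_edges (S - Q)"
      using e(1) unfolding attached_edges_def by (cases "e \<inter> Q = {}") simp_all
  qed
  then have "card (attached_edges S) \<le> card (attached_edges Q) + card (attached_edges (S - Q))"
    using finite_attached_edges by (meson card_Un_le card_mono finite_UnI order_trans)
  then show ?thesis using removal_loses_edges[OF Q] by linarith
qed

definition tail :: "'a \<Rightarrow> 'a list \<Rightarrow> bool" where
  "tail a q \<longleftrightarrow> a \<in> set C \<and> q \<noteq> [] \<and> gpath G (a # q) \<and> set q \<inter> set C = {} \<and> last q \<in> S"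

definition longest_tail :: "'a \<Rightarrow> 'a list \<Rightarrow> bool" where
  "longest_tail a q \<longleftrightarrow> tail a q \<and> (\<forall>a' q'. tail a' q' \<longrightarrow> length q' \<le> length q)"

lemma longest_tail_if_same_length:
  "longest_tail a q \<Longrightarrow> tail a' q' \<Longrightarrow> length q' = length q \<Longrightarrow> longest_tail a' q'"
  by (simp add: longest_tail_def)

lemma exists_longest_tail:
  obtains a q where "longest_tail a q"
proof -
  obtain u where u: "u \<in> S" using S_not_empty by blast
  have "hd C \<in> set C" using length_C by (intro hd_in_set) auto
  then have "u \<in> verts G" "u \<notin> set C" "u \<noteq> hd C" using u S_off_C by auto
  then obtain q a where q: "gpath G (q @ [a])" "q \<noteq> []" "hd q = u" "a \<in> set C" "set q \<inter> set C = {}"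
    by (rule path_to_cycle)
  have "gpath G (a # rev q)" using q(1) gpath_rev[of G "q @ [a]"] by (simp del: gpath_rev)
  then have "tail a (rev q)" using q(2-5) u by (simp add: tail_def last_rev)
  moreover have "length q \<le> card (verts G)" if "tail a q" for a q
  proof -
    have "distinct q" "set q \<subseteq> verts G" using that by (auto simp: tail_def gpath_def)
    then show ?thesis using finite_verts by (metis card_mono distinct_card)
  qed
  ultimately have "\<exists>l. (\<exists>a q. tail a q \<and> length q = l) \<and>
      (\<forall>l'. (\<exists>a q. tail a q \<and> length q = l') \<longrightarrow> l' \<le> l)"
    by (intro Nat.ex_has_greatest_nat[of _ "length (rev q)" "card (verts G)"]) blast+
  then show thesis using that unfolding longest_tail_def by metis
qed

lemma longest_tail_end_off_cycle:
  assumes "longest_tail a q"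
  shows "nbhd G (last q) \<inter> S \<subseteq> set q - {last q}"
proof
  fix v assume v: "v \<in> nbhd G (last q) \<inter> S"
  have tail: "tail a q" using assms by (simp add: longest_tail_def)
  have "v \<in> set q"
  proof (rule ccontr)
    assume "v \<notin> set q"
    moreover have "v \<notin> set C" "v \<in> verts G" using v S_off_C by auto
    ultimately have "tail a (q @ [v])"
      using tail v gpath_append[of "a # q" "[v]"] by (auto simp: tail_def mem_nbhd_iff adj_commute)
    then show False using assms by (fastforce simp: longest_tail_def)
  qed
  then show "v \<in> set q - {last q}" using v by (auto simp: mem_nbhd_iff)
qed

lemma longest_tail_end_on_cycle:
  assumes "longest_tail a q"
  shows "nbhd G (last q) \<inter> set C - {a} \<noteq> {}"
proof
  let ?u = "last q"
  assume "nbhd G ?u \<inter> set C - {a} = {}"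
  then have "nbhd G ?u \<inter> set C \<subseteq> {a}" by blast
  then have "card (nbhd G ?u \<inter> set C) \<le> 1" using card_mono[of "{a}"] by fastforce
  moreover have tail: "tail a q" using assms by (simp add: longest_tail_def)
  ultimately have many: "k \<le> card (nbhd G ?u \<inter> S) + 1"
    using degree_ge[of ?u] by (simp add: tail_def)
  then have "card (nbhd G ?u \<inter> S) \<noteq> 0" using k(2) by linarith
  then have "nbhd G ?u \<inter> S \<noteq> {}" by (metis card.empty)
  then have "2 * card (nbhd G ?u \<inter> S) + 4 \<le> length C"
    using neighbours_on_hanging_path[of a q "nbhd G ?u \<inter> S"] tail
      longest_tail_end_off_cycle[OF assms]
    by (auto simp: tail_def)
  then show False using many length_C_le by linarith
qed

lemma longest_tail_end:
  assumes "longest_tail a q"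
  shows "a \<in> nbhd G (last q)" and "card (nbhd G (last q) \<inter> set C) + length q = k + 1"
    and "nbhd G (last q) \<inter> S = set q - {last q}"
proof -
  let ?u = "last q" and ?T = "nbhd G (last q) \<inter> set C"
  have tail: "tail a q" using assms by (simp add: longest_tail_def)
  have "2 * length q + 2 * card (?T - {a}) \<le> length C"
    using hanging_path_bound[OF _ _ _ _ longest_tail_end_on_cycle[OF assms]] tail
    by (simp add: tail_def)
  then have upper: "length q + card (?T - {a}) \<le> k" using length_C_le by linarith
  have card_q: "card (set q - {?u}) = length q - 1" "length q \<ge> 1"
    using tail by (auto simp: tail_def gpath_def distinct_card Suc_le_eq)
  then have few: "card (nbhd G ?u \<inter> S) \<le> length q - 1"
    using card_mono[OF _ longest_tail_end_off_cycle[OF assms]] by simp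
  have lower: "k \<le> card (nbhd G ?u \<inter> S) + card ?T"
    using degree_ge tail by (simp add: tail_def)
  have "a \<in> ?T"
  proof (rule ccontr)
    assume "a \<notin> ?T"
    then show False using upper lower few card_q(2) by simp
  qed
  moreover from this have "card ?T = card (?T - {a}) + 1"
    using finite_nbhd card.remove[of ?T a] by simp
  ultimately show "a \<in> nbhd G ?u" "card ?T + length q = k + 1"
    using upper lower few card_q(2) by (blast, linarith)
  then have "card (nbhd G ?u \<inter> S) = card (set q - {?u})"
    using lower few card_q by linarith
  then show "nbhd G ?u \<inter> S = set q - {?u}"
    using card_subset_eq[OF _ longest_tail_end_off_cycle[OF assms]] by simp
qed

lemma longest_tail_turn:
  assumes long: "longest_tail a q" and x: "x \<in> set q"
  obtains q' where "longest_tail a q'" "set q' = set q" "length q' = length q" "last q' = x"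
proof -
  have tail: "a \<in> set C" "q \<noteq> []" "gpath G (a # q)" "set q \<inter> set C = {}" "last q \<in> S"
    using long by (auto simp: longest_tail_def tail_def)
  obtain q1 q2 where q: "q = q1 @ x # q2" using split_list[OF x] by blast
  let ?q = "q1 @ rev (x # q2)"
  have "gpath G ((a # q1) @ x # q2)" using tail(3) q by simp
  then have parts: "gpath G (a # q1)" "gpath G (x # q2)" "set (a # q1) \<inter> set (x # q2) = {}"
    using gpath_append[of "a # q1" "x # q2" G] by auto
  have "last (a # q1) \<in> insert a (set q - {last q})"
  proof (cases "q1 = []")
    case False
    have "last q \<in> set (x # q2)" "last q1 \<in> set q1" "set q1 \<inter> set (x # q2) = {}"
      using parts(3) q False by auto
    then have "last q1 \<noteq> last q" by (metis IntI empty_iff)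
    then show ?thesis using q False by simp
  qed simp
  then have "last (a # q1) \<in> nbhd G (last q)"
    using longest_tail_end(1,3)[OF long] by (metis IntD1 insertE)
  then have "adj G (last (a # q1)) (last q)" by (simp only: mem_nbhd_iff)
  moreover have "hd (rev (x # q2)) = last q" using q by (simp only: hd_rev) simp
  ultimately have "gpath G ((a # q1) @ rev (x # q2))"
    using parts gpath_rev[of G "x # q2"] by (subst gpath_append) auto
  moreover have "x \<in> S"
    using x tail(5) longest_tail_end(3)[OF long] by (cases "x = last q") auto
  ultimately have "tail a ?q" using tail q by (auto simp: tail_def)
  then have "longest_tail a ?q" using longest_tail_if_same_length[OF long] q by simp
  then show thesis using that[of ?q] q by auto
qed

lemma longest_tail_vertex:
  assumes "longest_tail a q" "x \<in> set q"
  shows "a \<in> nbhd G x" and "card (nbhd G x \<inter> set C) + length q = k + 1"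
    and "nbhd G x \<inter> S = set q - {x}"
proof -
  obtain q' where "longest_tail a q'" "set q' = set q" "length q' = length q" "last q' = x"
    using longest_tail_turn[OF assms] .
  then show "a \<in> nbhd G x" "card (nbhd G x \<inter> set C) + length q = k + 1"
      "nbhd G x \<inter> S = set q - {x}"
    using longest_tail_end[of a q'] by auto
qed

lemma longest_tail_length_le:
  assumes "longest_tail a q"
  shows "length q \<le> 2"
proof -
  have tail: "tail a q" using assms by (simp add: longest_tail_def)
  have nonempty: "set q \<noteq> {}" and card: "card (set q) = length q"
    using tail by (auto simp: tail_def gpath_def distinct_card)
  have "set q - {last q} \<subseteq> S" using longest_tail_end(3)[OF assms] by blast
  then have "set q \<subseteq> S" using tail by (auto simp: tail_def)
  then have "(k - 1) * length q < card (attached_edges (set q))"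
    using closed_subset_dense[of "set q"] longest_tail_vertex(3)[OF assms] nonempty card by auto
  moreover have "card (nbhd G x \<inter> set C) \<le> k + 1 - length q" if "x \<in> set q" for x
    using longest_tail_vertex(2)[OF assms that] by linarith
  then have "2 * card (attached_edges (set q))
      \<le> length q * (length q - 1) + 2 * (k + 1 - length q) * length q"
    using card_attached_edges_le[of "set q"] card by simp
  ultimately have "length q * (2 * (k - 1)) < length q * (length q - 1 + 2 * (k + 1 - length q))"
    by (simp add: algebra_simps)
  then have "2 * (k - 1) < length q - 1 + 2 * (k + 1 - length q)" by simp
  moreover have "length q \<le> k + 1" using longest_tail_end(2)[OF assms] by linarith
  ultimately show ?thesis by linarith
qed

lemma longest_tail_length_neq_2:
  assumes "longest_tail a q"
  shows "length q \<noteq> 2"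
proof
  assume "length q = 2"
  then obtain x u where q: "q = [x, u]" by (auto simp: length_Suc_conv numeral_2_eq_2)
  have tail: "a \<in> set C" "gpath G [x, u]" "set [x, u] \<inter> set C = {}" "u \<in> S"
    using assms q by (auto simp: longest_tail_def tail_def gpath_Cons)
  let ?T = "\<lambda>y. nbhd G y \<inter> set C"
  have card: "card (?T x) = k - 1" "card (?T u) = k - 1"
    using longest_tail_vertex(2)[OF assms, of x] longest_tail_vertex(2)[OF assms, of u] q
    by simp_all
  have "?T x \<subseteq> ?T u"
  proof
    fix a' assume a': "a' \<in> ?T x"
    then have "a' \<notin> set [x, u]" using tail(3) by auto
    then have "tail a' q" using tail a' q C_verts by (auto simp: tail_def mem_nbhd_iff gpath_Cons)
    then have "longest_tail a' q" using longest_tail_if_same_length[OF assms] by blast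
    then show "a' \<in> ?T u" using longest_tail_end(1) a' q by fastforce
  qed
  then have same: "?T x = ?T u" using card_subset_eq[of "?T u" "?T x"] finite_nbhd card by simp
  have ears: "\<exists>D. length D = 2 \<and> ear s D b" if sb: "s \<in> ?T u" "b \<in> ?T u" "s \<noteq> b" for s b
  proof -
    have "s \<in> ?T x" using sb(1) same by simp
    then have "ear s [x, u] b"
      using sb tail C_verts by (auto simp: ear_def gpath_Cons mem_nbhd_iff adj_commute)
    then show ?thesis by (intro exI[of _ "[x, u]"]) simp
  qed
  have a: "a \<in> ?T u" using longest_tail_end(1)[OF assms] q tail(1) by simp
  then have "card (?T u - {a}) = k - 2" using card(2) finite_nbhd by simp
  moreover from this have "card (?T u - {a}) \<noteq> 0" using k(2) by linarith
  then have "?T u - {a} \<noteq> {}" by (metis card.empty)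
  then have "2 * 2 + 2 + (2 + 1) * (card (?T u - {a}) - 1) \<le> length C"
    using ears a by (intro spaced_attachments[OF _ _ tail(1)]) auto
  ultimately show False using length_C_le k(2) by simp
qed

lemma vertex_with_half_nbhd:
  obtains v where "v \<in> S" "card (nbhd G v \<inter> set C) = k"
proof -
  obtain a q where q: "longest_tail a q" using exists_longest_tail .
  then have "q \<noteq> []" "last q \<in> S" by (auto simp: longest_tail_def tail_def)
  moreover from this have "length q \<ge> 1" by (simp add: Suc_le_eq)
  then have "length q = 1"
    using longest_tail_length_le[OF q] longest_tail_length_neq_2[OF q] by linarith
  ultimately show thesis using that[of "last q"] longest_tail_end(2)[OF q] by simp
qed

end

lemma (in longest_cycle_graph) exists_half_vertex:
  assumes long: "10 \<le> length C"
    and many: "(length C div 2 - 1) * card (verts G - set C)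
      < card {e \<in> edges G. card (e \<inter> set C) \<le> 1}"
  obtains v where "v \<in> verts G" "v \<notin> set C" "nbhd G v \<subseteq> set C" "card (nbhd G v) = length C div 2"
proof -
  let ?k = "length C div 2"
  define dense where
    "dense S \<longleftrightarrow> S \<subseteq> verts G - set C \<and> (?k - 1) * card S < card (attached_edges S)" for S
  have "dense (verts G - set C)"
    using many card_mono[OF finite_attached_edges edges_off_cycle_attached] by (simp add: dense_def)
  then obtain S where "dense S" "\<And>S'. dense S' \<Longrightarrow> card S \<le> card S'"
    using ex_has_least_nat[of dense _ card] by blast
  then interpret minimal_dense_set G C ?k S
    using long by unfold_locales (auto simp: dense_def)
  obtain v where v: "v \<in> S" "card (nbhd G v \<inter> set C) = ?k" using vertex_with_half_nbhd .
  then have off: "v \<in> verts G" "v \<notin> set C" using S_off_C by auto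
  then have "nbhd G v \<subseteq> set C" using nbhd_subset_cycle_if_half v(2) long by simp
  then show thesis using that off v(2) by (simp add: inf.absorb1)
qed

section \<open>Star forests and the three families\<close>

definition adj_off :: "'a sgraph \<Rightarrow> 'a set \<Rightarrow> 'a \<Rightarrow> 'a \<Rightarrow> bool" where
  "adj_off G A u w \<longleftrightarrow> adj G u w \<and> u \<notin> A \<and> w \<notin> A"

lemma adj_off_commute: "adj_off G A u w \<longleftrightarrow> adj_off G A w u"
  by (auto simp: adj_off_def adj_commute)

definition image_graph :: "('a \<Rightarrow> 'b) \<Rightarrow> 'a sgraph \<Rightarrow> 'b sgraph" where
  "image_graph f G = \<lparr>verts = f ` verts G, edges = (`) f ` edges G\<rparr>"

definition fill :: "'a sgraph \<Rightarrow> 'a set \<Rightarrow> 'a set \<Rightarrow> 'a sgraph" where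
  "fill G A B = \<lparr>verts = verts G, edges = edges G \<union> {{u, w} | u w. u \<in> A \<and> w \<in> A \<union> B \<and> u \<noteq> w}\<rparr>"

lemma verts_fill [simp]: "verts (fill G A B) = verts G"
  by (simp add: fill_def)

lemma edges_fill: "edges (fill G A B) = edges G \<union> {{u, w} | u w. u \<in> A \<and> w \<in> A \<union> B \<and> u \<noteq> w}"
  by (simp add: fill_def)

lemma adj_fill_iff: "w \<notin> A \<union> B \<Longrightarrow> {u, w} \<in> edges (fill G A B) \<longleftrightarrow> adj G u w"
  by (auto simp: edges_fill adj_def doubleton_eq_iff)

lemma nbhd_fill: "w \<notin> A \<union> B \<Longrightarrow> nbhd (fill G A B) w = nbhd G w"
  by (simp add: nbhd_def adj_fill_iff) (simp add: adj_def)

lemma clique_fill: "clique (fill G A B) A"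
  by (auto simp: clique_def edges_fill)

lemma completely_joined_fill: "A \<inter> B = {} \<Longrightarrow> completely_joined (fill G A B) A B"
  by (auto simp: completely_joined_def edges_fill)

lemma independent_fill:
  assumes "A \<inter> B = {}" "\<And>u w. u \<in> B \<Longrightarrow> w \<in> B \<Longrightarrow> \<not> adj G u w"
  shows "independent (fill G A B) B"
proof -
  have "{u, w} \<notin> edges (fill G A B)" if "u \<in> B" "w \<in> B" for u w
  proof -
    have "u \<notin> A" "w \<notin> A" using that assms(1) by auto
    then show ?thesis using assms(2)[OF that] by (auto simp: edges_fill adj_def doubleton_eq_iff)
  qed
  then show ?thesis by (simp add: independent_def)
qed

lemma simple_graph_fill:
  assumes "simple_graph G" "A \<union> B \<subseteq> verts G"
  shows "simple_graph (fill G A B)"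
  unfolding simple_graph_def
proof (intro conjI ballI)
  fix e assume "e \<in> edges (fill G A B)"
  then consider "e \<in> edges G" | u w where "e = {u, w}" "u \<in> A" "w \<in> A \<union> B" "u \<noteq> w"
    by (auto simp: edges_fill)
  then have "e \<subseteq> verts G \<and> card e = 2"
    using assms by cases (auto simp: simple_graph_def)
  then show "e \<subseteq> verts (fill G A B)" "card e = 2" by auto
qed (use assms(1) in \<open>simp add: simple_graph_def\<close>)

lemma subgraph_fill: "simple_graph G \<Longrightarrow> subgraph G (fill G A B)"
  by (simp add: subgraph_def edges_fill)

context finite_graph
begin

lemma reachable_adj: "reachable G u v \<Longrightarrow> adj G v w \<Longrightarrow> reachable G u w"
  unfolding reachable_def adj_def by (rule rtrancl_into_rtrancl) simp_all

lemma reachable_self: "reachable G u u"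
  by (simp add: reachable_def)

lemma component_closed: "K \<in> components G \<Longrightarrow> s \<in> K \<Longrightarrow> adj G s t \<Longrightarrow> t \<in> K"
  using reachable_adj adj_verts(2) by (auto simp: components_def)

lemma component_subset: "K \<in> components G \<Longrightarrow> K \<subseteq> verts G"
  by (auto simp: components_def)

lemma component_of_vertex:
  assumes "u \<in> verts G"
  obtains K where "K \<in> components G" "u \<in> K"
  using assms reachable_self by (auto simp: components_def)

lemma finite_components: "finite (components G)"
  by (rule finite_subset[of _ "Pow (verts G)"]) (use component_subset finite_verts in auto)

lemma component_star_centre:
  assumes walks: "\<And>p q r t. adj G p q \<Longrightarrow> adj G q r \<Longrightarrow> adj G r t \<Longrightarrow> p = r \<or> q = t"
    and K: "K \<in> components G"
  obtains z where "z \<in> K" "K = insert z (nbhd G z)"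
proof -
  obtain u where u: "u \<in> verts G" "K = {v \<in> verts G. reachable G u v}"
    using K by (auto simp: components_def)
  obtain z where z: "z = u \<or> adj G u z" and stop: "\<And>s r. adj G z s \<Longrightarrow> adj G s r \<Longrightarrow> r = z"
  proof (cases "\<exists>t w. adj G u t \<and> adj G t w \<and> w \<noteq> u")
    case True
    then obtain t w where t: "adj G u t" "adj G t w" "w \<noteq> u" by blast
    have "r = t" if "adj G t s" "adj G s r" for s r
      using walks[of r s t u] walks[of r s t w] that t by (auto simp: adj_commute)
    then show thesis using that[of t] t(1) by blast
  qed (use that[of u] in blast)
  have "reachable G u z" using z reachable_self reachable_adj by blast
  moreover have "z \<in> verts G" using z u(1) adj_verts(2) by blast
  ultimately have zK: "z \<in> K" using u(2) by simp
  have "v \<in> insert z (nbhd G z)" if "(u, v) \<in> {(x, y). {x, y} \<in> edges G}\<^sup>*" for v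
    using that
  proof (induction rule: rtrancl_induct)
    case base
    then show ?case using z by (auto simp: mem_nbhd_iff)
  next
    case (step y v)
    then have "adj G y v" by (simp add: adj_def)
    then show ?case using step.IH stop[of y v] by (auto simp: mem_nbhd_iff adj_commute)
  qed
  then have "K \<subseteq> insert z (nbhd G z)" unfolding u(2) by (auto simp: reachable_def)
  moreover have "nbhd G z \<subseteq> K"
    using component_closed[OF K zK] by (auto simp: mem_nbhd_iff adj_commute)
  ultimately show thesis using that[OF zK] zK by blast
qed

lemma star_forest_if_walks_turn:
  assumes walks: "\<And>p q r t. adj G p q \<Longrightarrow> adj G q r \<Longrightarrow> adj G r t \<Longrightarrow> p = r \<or> q = t"
  shows "star_forest G"
  unfolding star_forest_def
proof
  fix K assume K: "K \<in> components G"
  obtain z where z: "z \<in> K" "K = insert z (nbhd G z)" using component_star_centre[OF walks K] .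
  have "edges (induced G K) = {{z, x} | x. x \<in> K - {z}}"
  proof
    show "edges (induced G K) \<subseteq> {{z, x} | x. x \<in> K - {z}}"
    proof
      fix e assume "e \<in> edges (induced G K)"
      then have e: "e \<in> edges G" "e \<subseteq> K" by (auto simp: induced_def)
      have "z \<in> e"
      proof (rule ccontr)
        assume ze: "z \<notin> e"
        obtain s t where st: "e = {s, t}" "adj G s t" using e(1) by (rule edgeE)
        have "s \<noteq> z" "t \<noteq> z" "s \<in> insert z (nbhd G z)" "t \<in> insert z (nbhd G z)"
          using e(2) ze unfolding st(1) z(2)[symmetric] by auto
        then have "adj G z s" "adj G t z" by (simp_all add: mem_nbhd_iff adj_commute)
        then have "z = t \<or> s = z" using walks st(2) by blast
        then show False using \<open>s \<noteq> z\<close> \<open>t \<noteq> z\<close> by simp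
      qed
      with e(1) obtain x where x: "e = {z, x}" "adj G x z" by (rule edge_atE)
      then have "x \<in> K - {z}" using e(2) adj_verts(3)[OF x(2)] by simp
      then show "e \<in> {{z, x} | x. x \<in> K - {z}}" using x(1) by blast
    qed
    show "{{z, x} | x. x \<in> K - {z}} \<subseteq> edges (induced G K)"
    proof
      fix e assume "e \<in> {{z, x} | x. x \<in> K - {z}}"
      then obtain x where x: "e = {z, x}" "x \<in> K" "x \<noteq> z" by blast
      then have "adj G z x" using z(2) by (auto simp: mem_nbhd_iff adj_commute)
      then show "e \<in> edges (induced G K)" using x z(1) by (auto simp: induced_def adj_def)
    qed
  qed
  moreover have "verts (induced G K) = K" using component_subset[OF K] by (auto simp: induced_def)
  ultimately show "is_star (induced G K)" using z(1) by (auto simp: is_star_def)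
qed

end

locale attached_star = finite_graph +
  fixes A :: "'a set" and z w :: 'a
  assumes A_verts: "A \<subseteq> verts G" and z: "z \<in> verts G - A" and w: "w \<in> A"
    and centre: "adj_off G A u u' \<Longrightarrow> u = z \<or> u' = z"
    and leaf: "adj_off G A z l \<Longrightarrow> nbhd G l = {w, z}"
begin

lemma fill_mem_X_family:
  assumes "card A = c div 2"
  shows "\<exists>B. fill G A B \<in> X_family (card (verts G)) c"
proof -
  define L where "L = {l. adj_off G A z l}"
  define B where "B = verts G - A - L"
  have L: "L \<subseteq> verts G - A" "z \<notin> L" using adj_verts by (auto simp: L_def adj_off_def)
  have zB: "z \<in> B" using z L(2) by (simp add: B_def)
  have "\<not> adj G u u'" if "u \<in> B" "u' \<in> B" for u u'
    using centre[of u u'] that by (auto simp: B_def L_def adj_off_def adj_commute)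
  then have "independent (fill G A B) B" by (intro independent_fill) (auto simp: B_def)
  moreover have LAB: "l \<notin> A \<union> B" if "l \<in> L" for l using that L by (auto simp: B_def)
  then have "nbhd (fill G A B) l = {w, z}" if "l \<in> L" for l
    using that nbhd_fill leaf by (metis L_def mem_Collect_eq)
  moreover have "independent (fill G A B) L"
    unfolding independent_def
  proof (intro ballI notI)
    fix u l assume "u \<in> L" "l \<in> L" "{u, l} \<in> edges (fill G A B)"
    then show False using adj_fill_iff[OF LAB] centre[of u l] L by (auto simp: adj_off_def)
  qed
  moreover have "simple_graph (fill G A B)"
    using simple A_verts by (intro simple_graph_fill) (auto simp: B_def)
  moreover have "completely_joined (fill G A B) A B"
    by (intro completely_joined_fill) (auto simp: B_def)
  moreover have "verts G = A \<union> B \<union> L" "A \<inter> B = {}" "A \<inter> L = {}" "B \<inter> L = {}"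
    using A_verts L by (auto simp: B_def)
  ultimately have "fill G A B \<in> X_family (card (verts G)) c"
    using assms w zB clique_fill unfolding X_family_def
    by (intro CollectI conjI exI[of _ A] exI[of _ B] exI[of _ L] bexI[of _ w] bexI[of _ z]) simp_all
  then show ?thesis ..
qed

end

locale attached_star_forest = finite_graph +
  fixes A :: "'a set" and a b :: 'a
  assumes A_verts: "A \<subseteq> verts G" and ab: "a \<in> A" "b \<in> A"
    and walks_turn: "adj_off G A p q \<Longrightarrow> adj_off G A q r \<Longrightarrow> adj_off G A r t \<Longrightarrow> p = r \<or> q = t"
    and edge_nbrs: "adj_off G A u u' \<Longrightarrow> (nbhd G u \<union> nbhd G u') \<inter> A = {a, b}"
    and common_nbr: "adj_off G A p q \<Longrightarrow> adj_off G A q r \<Longrightarrow> p \<noteq> r \<Longrightarrow>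
      \<exists>d. nbhd G p \<inter> A = {d} \<and> nbhd G r \<inter> A = {d}"
    and two_edges: "\<exists>p q r t. adj_off G A p q \<and> adj_off G A r t \<and> {p, q} \<inter> {r, t} = {}"
begin

definition Y :: "'a set" where
  "Y = {u. \<exists>u'. adj_off G A u u'}"

definition B :: "'a set" where
  "B = verts G - A - Y"

abbreviation H :: "'a sgraph" where
  "H \<equiv> fill G A B"

abbreviation F :: "'a sgraph" where
  "F \<equiv> induced H Y"

lemma Y_subset: "Y \<subseteq> verts G - A"
  using adj_verts(1) by (auto simp: Y_def adj_off_def)

lemma Y_off_AB: "u \<in> Y \<Longrightarrow> u \<notin> A \<union> B"
  using Y_subset by (auto simp: B_def)

lemma mem_Y_if_adj_off: "adj_off G A u u' \<Longrightarrow> u \<in> Y" "adj_off G A u u' \<Longrightarrow> u' \<in> Y"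
  using adj_off_commute[of G A u u'] by (auto simp: Y_def)

lemma simple_graph_H: "simple_graph H"
  using simple A_verts by (intro simple_graph_fill) (auto simp: B_def)

sublocale F: finite_graph F
  by unfold_locales (rule simple_graph_induced[OF simple_graph_H])

lemma verts_F: "verts F = Y"
  using Y_subset by (auto simp: induced_def)

lemma adj_F_iff: "adj F u u' \<longleftrightarrow> adj_off G A u u'"
proof
  assume "adj F u u'"
  then have "u \<in> Y" "u' \<in> Y" "{u, u'} \<in> edges H" by (auto simp: adj_def induced_def)
  then show "adj_off G A u u'" using adj_fill_iff[OF Y_off_AB] Y_subset by (auto simp: adj_off_def)
next
  assume off: "adj_off G A u u'"
  then have "{u, u'} \<in> edges H"
    using adj_fill_iff[OF Y_off_AB] mem_Y_if_adj_off by (auto simp: adj_off_def)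
  then show "adj F u u'" using mem_Y_if_adj_off[OF off] by (simp add: adj_def induced_def)
qed

lemma nbhd_H: "u \<in> Y \<Longrightarrow> nbhd H u = nbhd G u"
  using nbhd_fill[OF Y_off_AB] .

lemma component_adj_off_closed: "K \<in> components F \<Longrightarrow> s \<in> K \<Longrightarrow> adj_off G A s t \<Longrightarrow> t \<in> K"
  using F.component_closed[of K s t] by (simp only: adj_F_iff)

lemma component_F_subset: "K \<in> components F \<Longrightarrow> K \<subseteq> Y"
  using F.component_subset verts_F by auto

lemma component_centre:
  assumes "K \<in> components F"
  obtains z where "z \<in> K" "K = insert z {t. adj_off G A z t}"
proof -
  obtain z where "z \<in> K" "K = insert z (nbhd F z)"
    using F.component_star_centre[OF _ assms] walks_turn unfolding adj_F_iff by blast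
  then show thesis
    using that[of z] by (simp add: F.mem_nbhd_iff adj_F_iff adj_off_commute set_eq_iff)
qed

lemma star_forest_F: "star_forest F"
  by (rule F.star_forest_if_walks_turn) (use walks_turn in \<open>simp add: adj_F_iff\<close>)

lemma component_has_edge:
  assumes "K \<in> components F"
  obtains u u' where "u \<in> K" "u' \<in> K" "adj_off G A u u'"
proof -
  obtain z where "z \<in> K" using component_centre[OF assms] .
  moreover from this obtain t where "adj_off G A z t"
    using component_F_subset[OF assms] by (auto simp: Y_def)
  ultimately show thesis using that component_adj_off_closed[OF assms] by blast
qed

lemma edges_component_not_empty:
  assumes "K \<in> components F"
  shows "edges (induced H K) \<noteq> {}"
proof -
  obtain u u' where u: "u \<in> K" "u' \<in> K" "adj_off G A u u'" using component_has_edge[OF assms] .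
  then have "{u, u'} \<in> edges F" using adj_F_iff[of u u'] by (simp only: adj_def)
  then have "{u, u'} \<in> edges (induced H K)" using u by (simp add: induced_def)
  then show ?thesis by blast
qed

lemma two_components: "2 \<le> card (components F)"
proof -
  obtain p q r t where edges: "adj_off G A p q" "adj_off G A r t" "{p, q} \<inter> {r, t} = {}"
    using two_edges by blast
  obtain K where K: "K \<in> components F" "p \<in> K"
    using F.component_of_vertex[of p] mem_Y_if_adj_off(1)[OF edges(1)] verts_F by auto
  obtain L where L: "L \<in> components F" "r \<in> L"
    using F.component_of_vertex[of r] mem_Y_if_adj_off(1)[OF edges(2)] verts_F by auto
  have "K \<noteq> L"
  proof
    assume "K = L"
    then have in_K: "p \<in> K" "q \<in> K" "r \<in> K" "t \<in> K"
      using K L edges(1,2) component_adj_off_closed by blast+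
    obtain z where z: "K = insert z {t. adj_off G A z t}" using component_centre[OF K(1)] .
    have "z \<in> {s, s'}" if "adj_off G A s s'" "s \<in> K" "s' \<in> K" for s s'
      using walks_turn[of z s s' z] that z by (auto simp: adj_off_commute)
    then have "z \<in> {p, q}" "z \<in> {r, t}" using edges(1,2) in_K by simp_all
    then show False using edges(3) by blast
  qed
  then have "card {K, L} = 2" by simp
  moreover have "card {K, L} \<le> card (components F)"
    using K(1) L(1) F.finite_components by (intro card_mono) auto
  ultimately show ?thesis by simp
qed

lemma set_nbhd_component:
  assumes K: "K \<in> components F"
  shows "set_nbhd H K = {a, b}"
proof
  note KY = component_F_subset[OF K]
  have adj_H: "{u, s} \<in> edges H \<longleftrightarrow> u \<in> nbhd G s" if "s \<in> K" for u s
    using adj_fill_iff[OF Y_off_AB] that KY by (auto simp: mem_nbhd_iff)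
  show "set_nbhd H K \<subseteq> {a, b}"
  proof
    fix u assume "u \<in> set_nbhd H K"
    then obtain s where s: "u \<notin> K" "s \<in> K" "u \<in> nbhd G s" by (auto simp: set_nbhd_def adj_H)
    have "u \<in> A"
    proof (rule ccontr)
      assume "u \<notin> A"
      then have "adj_off G A s u"
        using s KY Y_subset by (auto simp: adj_off_def mem_nbhd_iff adj_commute)
      then show False using component_adj_off_closed[OF K s(2)] s(1) by blast
    qed
    moreover obtain s' where "adj_off G A s s'" using s(2) KY by (auto simp: Y_def)
    ultimately show "u \<in> {a, b}" using edge_nbrs s(3) by blast
  qed
  show "{a, b} \<subseteq> set_nbhd H K"
  proof
    fix u assume u: "u \<in> {a, b}"
    obtain s s' where s: "s \<in> K" "s' \<in> K" "adj_off G A s s'" using component_has_edge[OF K] .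
    then obtain r where r: "r \<in> K" "u \<in> nbhd G r" using edge_nbrs[OF s(3)] u by blast
    have "u \<notin> K" "u \<in> verts H" using u ab KY Y_subset A_verts by auto
    then show "u \<in> set_nbhd H K" using r adj_H[OF r(1)] by (auto simp: set_nbhd_def)
  qed
qed

lemma leaf_nbhd:
  assumes K: "K \<in> components F" and z: "z \<in> K" "K = insert z {t. adj_off G A z t}"
    and tt': "adj_off G A z t" "adj_off G A z t'" "t \<noteq> t'" and d: "nbhd G t \<inter> A = {d}"
    and l: "l \<in> leaves (induced H K)"
  shows "nbhd H l = {z, d}"
proof -
  have KY: "K \<subseteq> Y" using component_F_subset[OF K] .
  have l': "l \<in> K" "card (nbhd (induced H K) l) = 1"
    using l KY Y_subset by (auto simp: leaves_def degree_def induced_def)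
  have nbhd_K: "nbhd (induced H K) u = {t. adj_off G A u t}" if "u \<in> K" for u
  proof -
    have "{t, u} \<in> edges (induced H K) \<longleftrightarrow> t \<in> K \<and> adj_off G A u t" for t
      using adj_F_iff[of t u] that KY by (auto simp: adj_def induced_def adj_off_commute)
    then show ?thesis
      using component_adj_off_closed[OF K that] KY Y_subset by (auto simp: nbhd_def induced_def)
  qed
  have "finite (nbhd (induced H K) z)"
    using finite_verts by (auto simp: nbhd_def induced_def)
  then have "card {t, t'} \<le> card (nbhd (induced H K) z)"
    using tt' nbhd_K[OF z(1)] by (intro card_mono) auto
  then have "l \<noteq> z" using l'(2) tt'(3) by auto
  then have zl: "adj_off G A z l" using l'(1) z(2) by auto
  then have "nbhd G l \<inter> A = {d}"
    using common_nbr[of t z l] tt'(1) d by (cases "l = t") (auto simp: adj_off_commute)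
  moreover have "nbhd G l - A = {z}"
  proof
    show "nbhd G l - A \<subseteq> {z}"
    proof
      fix u assume "u \<in> nbhd G l - A"
      then have lu: "adj_off G A l u" using zl by (auto simp: adj_off_def mem_nbhd_iff adj_commute)
      then have "adj_off G A z u \<or> u = z" using component_adj_off_closed[OF K l'(1)] z(2) by blast
      then show "u \<in> {z}" using walks_turn[of z l u z] zl lu \<open>l \<noteq> z\<close> by (auto simp: adj_off_commute)
    qed
    show "{z} \<subseteq> nbhd G l - A" using zl by (auto simp: adj_off_def mem_nbhd_iff)
  qed
  ultimately have "nbhd G l = {z, d}" by blast
  then show ?thesis using nbhd_H l'(1) KY by auto
qed

lemma leaves_of_large_component:
  assumes K: "K \<in> components F" "3 \<le> card K"
  shows "(\<forall>l\<in>leaves (induced H K). degree H l = 2) \<and>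
    (\<exists>d\<in>{a, b}. \<forall>l\<in>leaves (induced H K). d \<in> nbhd H l)"
proof -
  obtain z where z: "z \<in> K" "K = insert z {t. adj_off G A z t}" using component_centre[OF K(1)] .
  obtain t t' where tt': "adj_off G A z t" "adj_off G A z t'" "t \<noteq> t'"
  proof -
    have "card (K - {z}) \<ge> 2" using K(2) z(1) by (simp add: card_Diff_singleton_if)
    then obtain T where "T \<subseteq> K - {z}" "card T = 2" by (metis obtain_subset_with_card_n)
    then show thesis using that z(2) by (auto simp: card_2_iff)
  qed
  then obtain d where d: "nbhd G t \<inter> A = {d}"
    using common_nbr[of t z t'] by (auto simp: adj_off_commute)
  have "d \<in> A" "d \<in> (nbhd G z \<union> nbhd G t) \<inter> A" using d by auto
  then have "d \<noteq> z" "d \<in> {a, b}" using edge_nbrs[OF tt'(1)] tt'(1) by (auto simp: adj_off_def)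
  moreover have "nbhd H l = {z, d}" if "l \<in> leaves (induced H K)" for l
    using leaf_nbhd[OF K(1) z tt' d that] .
  ultimately show ?thesis by (auto simp: degree_def)
qed

lemma fill_mem_Y_family:
  assumes "card A = c div 2"
  shows "\<exists>B. fill G A B \<in> Y_family (card (verts G)) c"
proof -
  have "\<not> adj G u u'" if "u \<in> B" "u' \<in> B" for u u'
    using that by (auto simp: B_def Y_def adj_off_def)
  then have "independent H B" by (intro independent_fill) (auto simp: B_def)
  moreover have "completely_joined H A B" by (intro completely_joined_fill) (auto simp: B_def)
  moreover have "verts H = A \<union> B \<union> Y" "A \<inter> B = {}" "A \<inter> Y = {}" "B \<inter> Y = {}"
    using A_verts Y_subset by (auto simp: B_def)
  moreover have "\<exists>a\<in>A. \<exists>b\<in>A. \<forall>K\<in>components F. set_nbhd H K = {a, b} \<and> (3 \<le> card K \<longrightarrow>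
      (\<forall>l\<in>leaves (induced H K). degree H l = 2) \<and>
      (\<exists>d\<in>{a, b}. \<forall>l\<in>leaves (induced H K). d \<in> nbhd H l))"
    using set_nbhd_component leaves_of_large_component
    by (intro bexI[OF _ ab(1)] bexI[OF _ ab(2)] ballI) simp
  moreover have "card (verts H) = card (verts G)" by simp
  moreover have "\<forall>K\<in>components F. edges (induced H K) \<noteq> {}"
    using edges_component_not_empty by blast
  moreover note assms simple_graph_H clique_fill star_forest_F two_components
  ultimately have "H \<in> Y_family (card (verts G)) c"
    unfolding Y_family_def mem_Collect_eq
    by (intro conjI exI[of _ A] exI[of _ B] exI[of _ Y])
  then show ?thesis ..
qed

end

context finite_graph
begin

lemma edge_image_iff:
  assumes "inj_on f (verts G)" "u \<in> verts G" "w \<in> verts G"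
  shows "{f u, f w} \<in> edges (image_graph f G) \<longleftrightarrow> {u, w} \<in> edges G"
proof
  assume "{f u, f w} \<in> edges (image_graph f G)"
  then obtain e where e: "e \<in> edges G" "f ` {u, w} = f ` e" by (auto simp: image_graph_def)
  moreover have "e \<subseteq> verts G" using e(1) simple by (simp add: simple_graph_def)
  ultimately show "{u, w} \<in> edges G"
    using inj_on_image_eq_iff[OF assms(1), of "{u, w}" e] assms(2,3) by auto
qed (auto simp: image_graph_def intro: rev_image_eqI)

lemma simple_graph_image:
  assumes "inj_on f (verts G)"
  shows "simple_graph (image_graph f G)"
  unfolding simple_graph_def
proof (intro conjI ballI)
  fix e assume "e \<in> edges (image_graph f G)"
  then obtain d where d: "d \<in> edges G" "e = f ` d" by (auto simp: image_graph_def)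
  then have "d \<subseteq> verts G" "card d = 2" using simple by (auto simp: simple_graph_def)
  then show "e \<subseteq> verts (image_graph f G)" "card e = 2"
    using d(2) assms by (auto simp: image_graph_def card_image inj_on_subset)
qed (simp add: image_graph_def finite_verts)

lemma iso_to_subgraph_image:
  assumes "inj_on f (verts G)" "subgraph (image_graph f G) H"
  shows "iso_to_subgraph G H"
proof -
  have "isomorphic G (image_graph f G)"
    unfolding isomorphic_def
    using assms(1) edge_image_iff[OF assms(1)]
    by (intro exI[of _ f]) (simp add: image_graph_def bij_betw_def)
  then show ?thesis using assms(2) by (auto simp: iso_to_subgraph_def)
qed

lemma exists_nat_image:
  obtains f :: "'a \<Rightarrow> nat" where "inj_on f (verts G)"
  using finite_imp_inj_to_nat_seg[OF finite_verts] by blast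

end

locale injective_image = finite_graph +
  fixes f :: "'a \<Rightarrow> 'b" and A :: "'a set"
  assumes inj: "inj_on f (verts G)" and A_subset: "A \<subseteq> verts G"
begin

sublocale I: finite_graph "image_graph f G"
  by unfold_locales (rule simple_graph_image[OF inj])

lemma mem_image_A_iff: "u \<in> verts G \<Longrightarrow> f u \<in> f ` A \<longleftrightarrow> u \<in> A"
  using inj_on_image_mem_iff[OF inj _ A_subset] .

lemma adj_image_iff:
  assumes "u \<in> verts G" "w \<in> verts G"
  shows "adj (image_graph f G) (f u) (f w) \<longleftrightarrow> adj G u w"
  using edge_image_iff[OF inj assms] by (simp add: adj_def)

lemma adj_off_imageE:
  assumes "adj_off (image_graph f G) (f ` A) i j"
  obtains u w where "i = f u" "j = f w" "u \<in> verts G" "w \<in> verts G" "adj_off G A u w"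
proof -
  have "i \<in> f ` verts G" "j \<in> f ` verts G"
    using assms I.adj_verts[of i j] by (auto simp: adj_off_def image_graph_def)
  then obtain u w where "i = f u" "j = f w" "u \<in> verts G" "w \<in> verts G" by blast
  then show thesis using that assms adj_image_iff mem_image_A_iff by (simp add: adj_off_def)
qed

lemma adj_off_imageI: "adj_off G A u w \<Longrightarrow> adj_off (image_graph f G) (f ` A) (f u) (f w)"
  using adj_verts[of u w] adj_image_iff mem_image_A_iff by (simp add: adj_off_def)

lemma f_eq_iff: "u \<in> verts G \<Longrightarrow> w \<in> verts G \<Longrightarrow> f u = f w \<longleftrightarrow> u = w"
  using inj by (auto dest: inj_onD)

lemma nbhd_image:
  assumes u: "u \<in> verts G"
  shows "nbhd (image_graph f G) (f u) = f ` nbhd G u"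
proof
  show "nbhd (image_graph f G) (f u) \<subseteq> f ` nbhd G u"
    using adj_image_iff[OF _ u] by (auto simp: nbhd_def adj_def image_graph_def)
  show "f ` nbhd G u \<subseteq> nbhd (image_graph f G) (f u)"
    using adj_image_iff[OF _ u] nbhd_verts[of u] by (auto simp: mem_nbhd_iff I.mem_nbhd_iff)
qed

lemma image_Int_A: "U \<subseteq> verts G \<Longrightarrow> f ` U \<inter> f ` A = f ` (U \<inter> A)"
  using inj_on_image_Int[OF inj _ A_subset] by simp

end

context attached_star
begin

lemma attached_star_image:
  assumes inj: "inj_on f (verts G)"
  shows "attached_star (image_graph f G) (f ` A) (f z) (f w)"
proof -
  interpret injective_image G f A using inj A_verts by unfold_locales
  show ?thesis
  proof unfold_locales
    show "f z \<in> verts (image_graph f G) - f ` A"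
      using z mem_image_A_iff by (simp add: image_graph_def)
    fix i j assume "adj_off (image_graph f G) (f ` A) i j"
    then show "i = f z \<or> j = f z" using centre by (metis adj_off_imageE)
  next
    fix i assume "adj_off (image_graph f G) (f ` A) (f z) i"
    then obtain u l where l: "f z = f u" "i = f l" "u \<in> verts G" "l \<in> verts G" "adj_off G A u l"
      by (rule adj_off_imageE)
    then have "nbhd G l = {w, z}" using leaf z f_eq_iff by blast
    then show "nbhd (image_graph f G) i = {f w, f z}" using l nbhd_image by simp
  qed (use A_verts w in \<open>auto simp: image_graph_def\<close>)
qed

lemma embeds_in_X_family:
  assumes "card A = c div 2"
  shows "\<exists>H :: nat sgraph. H \<in> X_family (card (verts G)) c \<and> iso_to_subgraph G H"
proof -
  obtain f :: "'a \<Rightarrow> nat" where inj: "inj_on f (verts G)" by (rule exists_nat_image)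
  interpret I: attached_star "image_graph f G" "f ` A" "f z" "f w"
    using attached_star_image[OF inj] .
  have "card (f ` A) = c div 2" "card (verts (image_graph f G)) = card (verts G)"
    using assms inj A_verts by (simp_all add: image_graph_def card_image inj_on_subset)
  then show ?thesis
    using I.fill_mem_X_family[of c] iso_to_subgraph_image[OF inj] subgraph_fill[OF I.simple]
    by metis
qed

end

context attached_star_forest
begin

lemma attached_star_forest_image:
  assumes inj: "inj_on f (verts G)"
  shows "attached_star_forest (image_graph f G) (f ` A) (f a) (f b)"
proof -
  interpret injective_image G f A using inj A_verts by unfold_locales
  let ?off = "adj_off (image_graph f G) (f ` A)"
  show ?thesis
  proof unfold_locales
    fix p q r t assume "?off p q" "?off q r" "?off r t"
    then show "p = r \<or> q = t"
      using walks_turn by (metis adj_off_imageE f_eq_iff)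
  next
    fix u u' assume "?off u u'"
    then obtain s s' where s: "u = f s" "u' = f s'" "s \<in> verts G" "s' \<in> verts G" "adj_off G A s s'"
      by (rule adj_off_imageE)
    have "nbhd G s \<union> nbhd G s' \<subseteq> verts G" using nbhd_verts by simp
    then have "(f ` (nbhd G s \<union> nbhd G s')) \<inter> f ` A = f ` {a, b}"
      using image_Int_A edge_nbrs[OF s(5)] by metis
    then show "(nbhd (image_graph f G) u \<union> nbhd (image_graph f G) u') \<inter> f ` A = {f a, f b}"
      using s nbhd_image by (simp add: image_Un)
  next
    fix p q r assume o: "?off p q" "?off q r" "p \<noteq> r"
    obtain p' q' where p: "p = f p'" "q = f q'" "p' \<in> verts G" "q' \<in> verts G" "adj_off G A p' q'"
      using o(1) by (rule adj_off_imageE)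
    obtain s r' where r: "q = f s" "r = f r'" "s \<in> verts G" "r' \<in> verts G" "adj_off G A s r'"
      using o(2) by (rule adj_off_imageE)
    have "s = q'" "p' \<noteq> r'" using p r o(3) f_eq_iff by auto
    then obtain d where "nbhd G p' \<inter> A = {d}" "nbhd G r' \<inter> A = {d}"
      using common_nbr p(5) r(5) by blast
    then show "\<exists>d. nbhd (image_graph f G) p \<inter> f ` A = {d} \<and> nbhd (image_graph f G) r \<inter> f ` A = {d}"
      using p r nbhd_image image_Int_A[OF nbhd_verts] by (intro exI[of _ "f d"]) simp
  next
    obtain p q r t where o: "adj_off G A p q" "adj_off G A r t" "{p, q} \<inter> {r, t} = {}"
      using two_edges by blast
    then have "p \<in> verts G" "q \<in> verts G" "r \<in> verts G" "t \<in> verts G"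
      using mem_Y_if_adj_off Y_subset by blast+
    then have "{f p, f q} \<inter> {f r, f t} = {}" using o(3) f_eq_iff by auto
    then show "\<exists>p q r t. ?off p q \<and> ?off r t \<and> {p, q} \<inter> {r, t} = {}"
      using adj_off_imageI o(1,2) by blast
  qed (use A_verts ab in \<open>auto simp: image_graph_def\<close>)
qed

lemma embeds_in_Y_family:
  assumes "card A = c div 2"
  shows "\<exists>H :: nat sgraph. H \<in> Y_family (card (verts G)) c \<and> iso_to_subgraph G H"
proof -
  obtain f :: "'a \<Rightarrow> nat" where inj: "inj_on f (verts G)" by (rule exists_nat_image)
  interpret I: attached_star_forest "image_graph f G" "f ` A" "f a" "f b"
    using attached_star_forest_image[OF inj] .
  have "card (f ` A) = c div 2" "card (verts (image_graph f G)) = card (verts G)"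
    using assms inj A_verts by (simp_all add: image_graph_def card_image inj_on_subset)
  then show ?thesis
    using I.fill_mem_Y_family[of c] iso_to_subgraph_image[OF inj] subgraph_fill[OF I.simple]
    by metis
qed

end

lemma bij_betw_extend_lessThan:
  fixes f :: "'a \<Rightarrow> nat"
  assumes f: "bij_betw f A {..<card A}" and AB: "A \<subseteq> B" "finite B"
  obtains g where "bij_betw g B {..<card B}" "\<And>u. u \<in> A \<Longrightarrow> g u = f u"
proof -
  have "card (B - A) = card {card A..<card B}"
    using AB by (simp add: card_Diff_subset finite_subset)
  then obtain h where h: "bij_betw h (B - A) {card A..<card B}"
    using finite_same_card_bij[of "B - A" "{card A..<card B}"] AB(2) by auto
  define g where "g u = (if u \<in> A then f u else h u)" for u
  have "bij_betw g A {..<card A}" by (intro bij_betw_cong[THEN iffD1, OF _ f]) (simp add: g_def)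
  moreover have "bij_betw g (B - A) {card A..<card B}"
    by (intro bij_betw_cong[THEN iffD1, OF _ h]) (simp add: g_def)
  ultimately have "bij_betw g (A \<union> (B - A)) ({..<card A} \<union> {card A..<card B})"
    by (rule bij_betw_combine) auto
  moreover have "{..<card A} \<union> {card A..<card B} = {..<card B}"
    using card_mono[OF AB(2,1)] by auto
  moreover have "A \<union> (B - A) = B" using AB(1) by blast
  ultimately show thesis using that[of g] by (simp add: g_def)
qed

lemma bij_betw_nested_lessThan:
  assumes "A \<subseteq> B" "B \<subseteq> V" "finite V"
  obtains f :: "'a \<Rightarrow> nat" where "bij_betw f V {..<card V}" "\<And>u. u \<in> A \<Longrightarrow> f u < card A"
    "\<And>u. u \<in> B \<Longrightarrow> f u < card B"
proof -
  have fin: "finite B" "finite A"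
    using finite_subset[OF _ assms(3)] assms(1,2) by auto
  obtain f where f: "bij_betw f A {..<card A}"
    using ex_bij_betw_finite_nat[OF fin(2)] by (auto simp: atLeast0LessThan)
  obtain g where g: "bij_betw g B {..<card B}" "\<And>u. u \<in> A \<Longrightarrow> g u = f u"
    by (rule bij_betw_extend_lessThan[OF f assms(1) fin(1)]) blast
  obtain h where h: "bij_betw h V {..<card V}" "\<And>u. u \<in> B \<Longrightarrow> h u = g u"
    by (rule bij_betw_extend_lessThan[OF g(1) assms(2,3)]) blast
  have "h u < card A" if "u \<in> A" for u
    using that assms(1) h(2) g(2) bij_betwE[OF f] by auto
  moreover have "h u < card B" if "u \<in> B" for u using that h(2) bij_betwE[OF g(1)] by auto
  ultimately show thesis using that h(1) by blast
qed

lemma W_graph_edgeI: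
  assumes "i < n" "j < n" "i \<noteq> j" "i < k \<or> j < k \<or> i < c - k + 1 \<and> j < c - k + 1"
  shows "{i, j} \<in> edges (W_graph n k c)"
proof -
  have ordered: "{i, j} \<in> edges (W_graph n k c)"
    if "i < j" "j < n" "i < k \<or> j < c - k + 1" for i j
    using that by (cases "j < c - k + 1") (auto simp: W_graph_def)
  show ?thesis
    using assms ordered[of i j] ordered[of j i] by (cases "i < j") (auto simp: insert_commute)
qed

lemma (in finite_graph) embeds_in_W_graph:
  assumes A: "A \<subseteq> verts G" "card A = k" and M: "M \<subseteq> verts G - A" "k + card M \<le> c - k + 1"
    and off: "\<And>u u'. adj_off G A u u' \<Longrightarrow> u \<in> M \<and> u' \<in> M"
  shows "iso_to_subgraph G (W_graph (card (verts G)) k c)"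
proof -
  let ?n = "card (verts G)"
  have fin: "finite A" "finite M" "A \<union> M \<subseteq> verts G"
    using finite_subset[OF _ finite_verts] A(1) M(1) by auto
  obtain f where f: "bij_betw f (verts G) {..<?n}" "\<And>u. u \<in> A \<Longrightarrow> f u < card A"
      "\<And>u. u \<in> A \<union> M \<Longrightarrow> f u < card (A \<union> M)"
    by (rule bij_betw_nested_lessThan[OF Un_upper1 fin(3) finite_verts]) blast
  have "card (A \<union> M) = k + card M" using fin M(1) A(2) by (subst card_Un_disjoint) auto
  then have small: "f u < c - k + 1" if "u \<in> M" for u using that f(3)[of u] M(2) by simp
  have "{f u, f u'} \<in> edges (W_graph ?n k c)" if "adj G u u'" for u u'
  proof (rule W_graph_edgeI)
    show "f u < ?n" "f u' < ?n" "f u \<noteq> f u'"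
      using f(1) adj_verts[OF that] by (auto simp: bij_betw_def inj_on_def)
    show "f u < k \<or> f u' < k \<or> f u < c - k + 1 \<and> f u' < c - k + 1"
    proof (cases "u \<in> A \<or> u' \<in> A")
      case True
      then show ?thesis using f(2) A(2) by blast
    next
      case False
      then show ?thesis using off[of u u'] small that by (simp add: adj_off_def)
    qed
  qed
  then have "edges (image_graph f G) \<subseteq> edges (W_graph ?n k c)"
    by (auto simp: image_graph_def elim!: edgeE)
  moreover have inj: "inj_on f (verts G)" and "f ` verts G = {..<?n}"
    using f(1) by (simp_all add: bij_betw_def)
  then have "verts (image_graph f G) = verts (W_graph ?n k c)"
    by (simp add: image_graph_def W_graph_def)
  ultimately have "subgraph (image_graph f G) (W_graph ?n k c)"
    using simple_graph_image[OF inj] by (simp add: subgraph_def)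
  then show ?thesis using iso_to_subgraph_image[OF inj] by blast
qed

section \<open>The alternating structure of the cycle\<close>

lemma no_consecutive_evens:
  assumes I: "I \<subseteq> {..<2 * k - 1}" "card I = k" and gap: "\<And>i. i \<in> I \<Longrightarrow> Suc i \<notin> I"
  shows "I = (\<lambda>i. 2 * i) ` {..<k}"
proof -
  have fin: "finite I" using I(1) finite_subset by blast
  have "i div 2 \<noteq> j div 2" if "i \<in> I" "j \<in> I" "i < j" for i j
  proof
    assume "i div 2 = j div 2"
    then have "j = Suc i" using that(3) by presburger
    then show False using gap that by blast
  qed
  then have "inj_on (\<lambda>i. i div 2) I" by (rule linorder_inj_onI')
  then have "card ((\<lambda>i. i div 2) ` I) = card {..<k}" using card_image I(2) by fastforce
  moreover have "(\<lambda>i. i div 2) ` I \<subseteq> {..<k}" using I(1) by fastforce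
  ultimately have halves: "(\<lambda>i. i div 2) ` I = {..<k}" by (intro card_subset_eq) auto
  have even_or_odd: "2 * l \<in> I \<or> Suc (2 * l) \<in> I" if l: "l < k" for l
  proof -
    obtain i where i: "i \<in> I" "i div 2 = l" using halves l by (metis imageE lessThan_iff)
    then have "i = 2 * l \<or> i = Suc (2 * l)" by presburger
    then show ?thesis using i(1) by blast
  qed
  have from_top: "2 * (k - 1 - d) \<in> I" if "d < k" for d
    using that
  proof (induction d)
    case 0
    then have "Suc (2 * (k - 1)) \<notin> I" using I(1) by fastforce
    then show ?case using even_or_odd[of "k - 1"] 0 by simp
  next
    case (Suc d)
    then have "Suc (Suc (2 * (k - 1 - Suc d))) = 2 * (k - 1 - d)" by simp
    then have "Suc (2 * (k - 1 - Suc d)) \<notin> I" using gap Suc by fastforce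
    then show ?case using even_or_odd[of "k - 1 - Suc d"] Suc.prems by simp
  qed
  have "2 * i \<in> I" if "i < k" for i
    using from_top[of "k - 1 - i"] that by simp
  then have "(\<lambda>i. 2 * i) ` {..<k} \<subseteq> I" by blast
  moreover have "card ((\<lambda>i. 2 * i) ` {..<k}) = k" by (subst card_image) (auto simp: inj_on_def)
  ultimately show ?thesis using card_subset_eq[OF fin] I(2) by metis
qed

locale alternating_cycle = longest_cycle_graph +
  fixes k :: nat and v :: 'a
  assumes k: "k = length C div 2" "2 \<le> k"
    and v: "v \<in> verts G" "v \<notin> set C"
    and nbhd_v: "nbhd G v = (\<lambda>i. C ! (2 * i)) ` {..<k}"

context longest_cycle_graph
begin

lemma cyc_add_mult: "cyc (i + j * length C) = cyc i"
  by (simp add: cyc_def)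

lemma no_consecutive_nbrs:
  assumes v: "v \<in> verts G" "v \<notin> set C" and i: "cyc i \<in> nbhd G v"
  shows "cyc (Suc i) \<notin> nbhd G v"
proof
  assume "cyc (Suc i) \<in> nbhd G v"
  moreover have "C \<noteq> []" using length_C by auto
  then have "cyc i \<noteq> cyc (Suc i)"
    using inj_onD[OF inj_on_cyc[of i], of i "Suc i"] length_C by auto
  ultimately have "ear (cyc i) [v] (cyc (Suc i))"
    using i v cyc_in_C C_verts by (auto simp: ear_def mem_nbhd_iff gpath_Cons adj_commute)
  then show False using ear_gap[of i "[v]" "Suc i"] length_C by simp
qed

text \<open>On an odd cycle, going back two steps from a neighbour to another one again and again would
  finally lead to the successor of the first neighbour.\<close>

lemma exists_alternation_start:
  assumes v: "v \<in> verts G" "v \<notin> set C" and N: "nbhd G v \<subseteq> set C" "nbhd G v \<noteq> {}"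
  obtains p where "cyc p \<in> nbhd G v" "odd (length C) \<Longrightarrow> cyc (p + (length C - 2)) \<notin> nbhd G v"
proof -
  obtain p where p: "cyc p \<in> nbhd G v" using N set_C_cases by blast
  show thesis
  proof (rule ccontr)
    assume "\<not> thesis"
    then have odd: "odd (length C)"
        and step: "\<And>q. cyc q \<in> nbhd G v \<Longrightarrow> cyc (q + (length C - 2)) \<in> nbhd G v"
      using that p by blast+
    have iterate: "cyc (p + j * (length C - 2)) \<in> nbhd G v" for j
    proof (induction j)
      case (Suc j)
      moreover have "p + Suc j * (length C - 2) = (p + j * (length C - 2)) + (length C - 2)" by simp
      ultimately show ?case using step by metis
    qed (use p in simp)
    obtain h where "length C = 2 * h + 1" using odd p by (auto elim: oddE)
    then obtain l where l: "length C = 2 * Suc l + 1" using length_C by (cases h) auto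
    have "Suc l * (length C - 2) = Suc (l * length C)" unfolding l by (simp add: algebra_simps)
    then have "cyc (Suc p) \<in> nbhd G v"
      using iterate[of "Suc l"] cyc_add_mult[of "Suc p" l] by simp
    then show False using no_consecutive_nbrs v p by blast
  qed
qed

lemma exists_alternating_rotation:
  assumes k: "k = length C div 2" "2 \<le> k"
    and v: "v \<in> verts G" "v \<notin> set C" and N: "nbhd G v \<subseteq> set C" "card (nbhd G v) = k"
  obtains C' where "alternating_cycle G C' k v" "length C' = length C"
proof -
  let ?n = "length C"
  have "nbhd G v \<noteq> {}" using N(2) k(2) by auto
  then obtain p where p: "cyc p \<in> nbhd G v" "odd ?n \<Longrightarrow> cyc (p + (?n - 2)) \<notin> nbhd G v"
    using exists_alternation_start[OF v N(1)] by blast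
  define I where "I = {i. i < ?n \<and> cyc (p + i) \<in> nbhd G v}"
  have positions: "bij_betw (\<lambda>i. cyc (p + i)) I (nbhd G v)"
    using bij_betw_positions[OF N(1)] by (simp add: I_def)
  have "I \<subseteq> {..<2 * k - 1}"
  proof
    fix i assume i: "i \<in> I"
    have "Suc (p + (?n - 1)) = p + ?n" using length_C by simp
    then have "cyc (Suc (p + (?n - 1))) = cyc p" by (metis cyc_add_length(1))
    then have "cyc (p + (?n - 1)) \<notin> nbhd G v" using no_consecutive_nbrs[OF v] p(1) by metis
    then have "i \<noteq> ?n - 1" "odd ?n \<Longrightarrow> i \<noteq> ?n - 2" "i < ?n" using i p(2) by (auto simp: I_def)
    then show "i \<in> {..<2 * k - 1}" using k by (cases "odd ?n") (auto elim!: oddE evenE)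
  qed
  moreover have "card I = k" using bij_betw_same_card[OF positions] N(2) by simp
  moreover have "Suc i \<notin> I" if "i \<in> I" for i
    using that no_consecutive_nbrs[OF v, of "p + i"] by (auto simp: I_def)
  ultimately have "I = (\<lambda>i. 2 * i) ` {..<k}" by (rule no_consecutive_evens)
  then have "nbhd G v = (\<lambda>i. cyc (p + 2 * i)) ` {..<k}"
    using bij_betw_imp_surj_on[OF positions] by (simp add: image_image)
  also have "\<dots> = (\<lambda>i. arc p (p + ?n) ! (2 * i)) ` {..<k}"
    using k(1) by (intro image_cong) (auto simp: arc_def)
  finally have "alternating_cycle G (arc p (p + ?n)) k v"
    using longest_arc k v cyc_image by unfold_locales simp_all
  then show thesis using that[of "arc p (p + ?n)"] by simp
qed

end

context alternating_cycle
begin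

abbreviation A :: "'a set" where
  "A \<equiv> nbhd G v"

text \<open>On an even cycle this includes the last vertex of \<open>C\<close>, whose successor is \<open>cyc 0\<close>.\<close>

definition B :: "'a set" where
  "B = insert v {cyc i | i. i < length C \<and> odd i \<and> cyc (Suc i) \<in> A}"

abbreviation ends :: "'a set" where
  "ends \<equiv> {C ! 0, C ! (2 * k - 2)}"

lemma length_C_cases: "length C = 2 * k \<or> length C = 2 * k + 1"
  using k(1) by linarith

lemma cyc_even_mem_A: "i < k \<Longrightarrow> cyc (2 * i) \<in> A"
  using length_C_cases nbhd_v by (auto simp: cyc_nth)

lemma A_cases:
  assumes "a \<in> A"
  obtains i where "i < k" "a = cyc (2 * i)"
proof -
  obtain i where "i < k" "a = C ! (2 * i)" using assms nbhd_v by auto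
  then show thesis using that[of i] length_C_cases by (auto simp: cyc_nth)
qed

lemma cyc_mem_A_iff:
  assumes "j < length C"
  shows "cyc j \<in> A \<longleftrightarrow> even j \<and> j < 2 * k"
proof
  assume "cyc j \<in> A"
  then obtain i where i: "i < k" "cyc j = cyc (2 * i)" by (rule A_cases)
  then have "j = 2 * i" using inj_on_cyc[of 0] assms length_C_cases by (auto dest: inj_onD)
  then show "even j \<and> j < 2 * k" using i(1) by simp
qed (use cyc_even_mem_A in \<open>auto elim!: evenE\<close>)

lemma adj_v_iff: "adj G v b \<longleftrightarrow> b \<in> A"
  by (simp add: mem_nbhd_iff adj_commute)

lemma card_A: "card A = k"
proof -
  have "inj_on (\<lambda>i. C ! (2 * i)) {..<k}"
    using distinct_C length_C_cases by (auto simp: inj_on_def nth_eq_iff_index_eq)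
  then show ?thesis using card_image nbhd_v by fastforce
qed

lemma A_subset_C: "A \<subseteq> set C"
  using cyc_in_C A_cases by blast

lemma A_int_B: "A \<inter> B = {}"
  using v(2) A_subset_C cyc_mem_A_iff by (auto simp: B_def)

lemma cyc_mem_AB:
  assumes "i \<le> 2 * k - 2"
  shows "cyc i \<in> A \<union> B"
proof (cases "even i")
  case True
  then show ?thesis using assms k(2) cyc_mem_A_iff[of i] length_C_cases by auto
next
  case False
  then have "Suc i < 2 * k" using assms k(2) by presburger
  then have "cyc (Suc i) \<in> A" "i < length C"
    using False cyc_mem_A_iff[of "Suc i"] length_C_cases by auto
  then show ?thesis using False by (auto simp: B_def)
qed

lemma C_subset_AB_if_even:
  assumes "even (length C)"
  shows "set C \<subseteq> A \<union> B"
proof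
  fix b assume "b \<in> set C"
  then obtain j where j: "j < length C" "b = cyc j" by (rule set_C_cases)
  have len: "length C = 2 * k" using assms k(1) by auto
  show "b \<in> A \<union> B"
  proof (cases "j = 2 * k - 1")
    case True
    then have "Suc j = length C" "odd j" using len k(2) by auto
    then show ?thesis using j cyc_even_mem_A[of 0] k(2) by (auto simp: B_def)
  next
    case False
    then show ?thesis using j cyc_mem_AB[of j] len by auto
  qed
qed

lemma ear_from_gap_ends_in_A:
  assumes p: "p < length C" "odd p" "cyc (Suc p) \<in> A"
    and D: "ear (cyc p) D s" "v \<notin> set D"
  shows "s \<in> A"
proof (rule ccontr)
  assume "s \<notin> A"
  have "s \<in> set C" using D(1) by (simp add: ear_def)
  then obtain q where q: "q < length C" "s = cyc q" by (rule set_C_cases)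
  have "p \<noteq> q" using D(1) q(2) by (auto simp: ear_def gpath_def)
  have off: "set D \<inter> cyc ` J = {}" for J
    using D(1) cyc_in_C by (auto simp: ear_def)
  have path: "gpath G (cyc p # D @ [cyc q])" "gpath G (cyc q # rev D @ [cyc p])"
    using D(1) ear_rev[OF D(1)] q(2) by (simp_all add: ear_def)
  have pred: "cyc (j - 1) \<in> A" if "odd j" "j < length C" for j
    using that odd_pos[of j] cyc_mem_A_iff[of "j - 1"] length_C_cases by auto
  have "odd q \<or> q = 2 * k"
    using \<open>s \<notin> A\<close> q cyc_mem_A_iff length_C_cases by auto
  then consider (after) "odd q" "p < q" | (before) "odd q" "q < p" | (last) "q = 2 * k"
    using \<open>p \<noteq> q\<close> by linarith
  then show False
  proof cases
    case after
    then have "length D + (p - 1) + (q - 1) + 3 \<le> p + q"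
      using p q D(2) path off v pred adj_v_iff odd_pos[of p]
      by (intro reroute_predecessors) auto
    then show False by linarith
  next
    case before
    then have "length (rev D) + (q - 1) + (p - 1) + 3 \<le> q + p"
      using p q D(2) path off v pred adj_v_iff odd_pos[of q]
      by (intro reroute_predecessors) auto
    then show False by linarith
  next
    case last
    then have "length C = 2 * k + 1" "p < 2 * k"
      using q(1) p(1) \<open>p \<noteq> q\<close> length_C_cases by auto
    moreover from this have "cyc (Suc (2 * k)) \<in> A"
      using cyc_even_mem_A[of 0] cyc_add_length(3) k(2) by simp
    ultimately have "length D + p + q + 3 \<le> Suc p + length C"
      using p q D(2) path off v adj_v_iff k(2) last
      by (intro reroute_successors) auto
    then show False using \<open>length C = 2 * k + 1\<close> last by simp
  qed
qed

lemma ear_from_gap_trivial: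
  assumes p: "p < length C" "odd p" "cyc (Suc p) \<in> A"
    and D: "ear (cyc p) D s" "v \<notin> set D"
  shows "D = []"
proof -
  have "s \<in> set C" using D(1) by (simp add: ear_def)
  then obtain q where q: "q < length C" "s = cyc q" by (rule set_C_cases)
  then have q': "even q" "q < 2 * k" using ear_from_gap_ends_in_A[OF assms] cyc_mem_A_iff by auto
  have off: "set D \<inter> cyc ` J = {}" for J
    using D(1) cyc_in_C by (auto simp: ear_def)
  have path: "gpath G (cyc p # D @ [cyc q])" "gpath G (cyc q # rev D @ [cyc p])"
    using D(1) ear_rev[OF D(1)] q(2) by (simp_all add: ear_def)
  have A_even: "cyc j \<in> A" if "even j" "j < 2 * k" for j
    using that cyc_even_mem_A by (auto elim!: evenE)
  have "p < 2 * k" using p(1,2) length_C_cases by (cases "p = 2 * k") auto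
  have "p \<noteq> q" using p(2) q'(1) by blast
  then consider (successor) "q = Suc p" | (predecessor) "p = Suc q"
    | (before) "Suc q < p" | (after) "Suc p < q"
    by linarith
  then have "length D = 0"
  proof cases
    case successor
    then show ?thesis using ear_gap[of p D q] D(1) q length_C by simp
  next
    case predecessor
    then show ?thesis using ear_gap[of q "rev D" p] ear_rev[OF D(1)] q length_C by simp
  next
    case before
    then have "length (rev D) + q + p + 3 \<le> q + 2 + Suc p"
      using p q q' D(2) path off v adj_v_iff A_even[of "q + 2"] length_C_cases \<open>p < 2 * k\<close>
      by (intro reroute_successors) auto
    then show ?thesis by simp
  next
    case after
    then have "q \<ge> p + 3" using p(2) q'(1) by presburger
    then have "length D + (p - 1) + (q - 2) + 3 \<le> p + q"
      using p q q' D(2) path off v adj_v_iff A_even[of "q - 2"] A_even[of "p - 1"]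
        length_C_cases odd_pos[OF p(2)]
      by (intro reroute_predecessors) auto
    then show ?thesis using \<open>q \<ge> p + 3\<close> odd_pos[OF p(2)] by linarith
  qed
  then show ?thesis by simp
qed

lemma nbhd_B_subset:
  assumes b: "b \<in> B"
  shows "nbhd G b \<subseteq> A"
proof (cases "b = v")
  case False
  then obtain p where p: "p < length C" "odd p" "cyc (Suc p) \<in> A" "b = cyc p"
    using b by (auto simp: B_def)
  show ?thesis
  proof
    fix u assume "u \<in> nbhd G b"
    then have u: "adj G b u" "u \<in> verts G" "u \<noteq> b"
      using adj_verts by (auto simp: mem_nbhd_iff adj_commute)
    have "b \<notin> A" using A_int_B b by blast
    then have uv: "u \<noteq> v" using u(1) by (auto simp: mem_nbhd_iff)
    show "u \<in> A"
    proof (cases "u \<in> set C")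
      case True
      then have "ear (cyc p) [] u"
        using u p(4) cyc_in_C C_verts by (auto simp: ear_def gpath_Cons)
      then show ?thesis using ear_from_gap_ends_in_A[OF p(1-3)] by auto
    next
      case False
      obtain q s where q: "gpath G (q @ [s])" "q \<noteq> []" "hd q = u" "s \<in> set C" "set q \<inter> set C = {}"
          "b \<notin> set (q @ [s])"
        using u(2) False u(3) by (rule path_to_cycle)
      have "v \<notin> set q"
      proof
        assume "v \<in> set q"
        moreover have "gpath G q" using gpath_appendD(1)[OF q(1,2)] .
        moreover have "length q \<ge> 2"
          using calculation(1) q(2,3) uv by (cases q; cases "tl q") auto
        ultimately obtain y where "y \<in> set q" "adj G v y" using gpath_neighbour by metis
        then show False using q(5) A_subset_C by (auto simp: adj_v_iff)
      qed
      moreover have "ear (cyc p) q s"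
        using q u(1) p(4) cyc_in_C[of p] C_verts by (auto simp: ear_def gpath_Cons)
      ultimately show ?thesis using ear_from_gap_trivial[OF p(1-3)] q(2) by blast
    qed
  qed
qed simp

definition A_path :: "'a \<Rightarrow> 'a list \<Rightarrow> 'a \<Rightarrow> bool" where
  "A_path a P a' \<longleftrightarrow> a \<in> A \<and> a' \<in> A \<and> set P \<inter> A = {} \<and> gpath G (a # P @ [a'])"

lemma A_path_rev: "A_path a P a' \<Longrightarrow> A_path a' (rev P) a"
  using gpath_rev[of G "a # P @ [a']"] by (simp add: A_path_def del: gpath_rev)

lemma A_path_shortcut:
  assumes "A_path a (P @ z # Q) a'" "e \<in> A" "adj G z e" "e \<noteq> a'"
  shows "A_path e (z # Q) a'"
proof -
  have "gpath G ((a # P) @ z # Q @ [a'])" using assms(1) by (simp add: A_path_def)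
  then have "gpath G (z # Q @ [a'])" by (rule gpath_appendD(2)) simp
  then have "gpath G (e # z # Q @ [a'])"
    using assms nbhd_verts by (auto simp: gpath_Cons A_path_def adj_commute)
  then show ?thesis using assms by (auto simp: A_path_def)
qed

lemma A_path_of_gpath:
  assumes P: "gpath G P" "set P \<inter> A = {}"
    and a: "a \<in> nbhd G (hd P) \<inter> A" "a' \<in> nbhd G (last P) \<inter> A" "a \<noteq> a'"
  shows "A_path a P a'"
proof -
  have "P \<noteq> []" using gpath_not_Nil[OF P(1)] .
  moreover have "adj G a (hd P)" "adj G (last P) a'"
    using a by (auto simp: mem_nbhd_iff adj_commute)
  moreover have "a \<notin> set P" "a' \<notin> set P" using P(2) a by auto
  ultimately have "gpath G (P @ [a'])" "gpath G (a # P @ [a'])"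
    using P(1) a nbhd_verts by (auto simp: gpath_append gpath_Cons)
  then show ?thesis using P(2) a by (simp add: A_path_def)
qed

lemma A_path_off_B:
  assumes "A_path a P a'" "2 \<le> length P"
  shows "set P \<inter> B = {}"
proof (rule ccontr)
  assume "\<not> ?thesis"
  then obtain b where b: "b \<in> set P" "b \<in> B" by blast
  have "gpath G (P @ [a'])" "P \<noteq> []"
    using assms gpath_appendD(2)[of G "[a]" "P @ [a']"] by (auto simp: A_path_def)
  then have "gpath G P" by (rule gpath_appendD(1))
  then obtain y where "y \<in> set P" "adj G b y" using gpath_neighbour b(1) assms(2) by metis
  then show False
    using nbhd_B_subset[OF b(2)] assms(1) by (auto simp: A_path_def mem_nbhd_iff adj_commute)
qed

lemma A_path_from_first_bound:
  assumes P: "A_path (cyc 0) P a'"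
  shows "length P \<le> length C + 1 - 2 * k"
proof (cases "2 \<le> length P")
  case True
  obtain j where j: "j < k" "a' = cyc (2 * j)" using P A_cases by (auto simp: A_path_def)
  have "j \<noteq> 0" using P j(2) by (auto simp: A_path_def gpath_def)
  let ?J = "{length C..length C + (2 * j - 2)} \<union> {length C + 2 * j..2 * k - 2 + length C}"
  have "cyc i \<in> A \<union> B" if "i \<in> ?J" for i
  proof -
    have "length C \<le> i" "i \<le> 2 * k - 2 + length C" using that j(1) by auto
    then show ?thesis
      using cyc_mem_AB[of "i - length C"] cyc_add_length(1)[of "i - length C"] by simp
  qed
  then have "cyc ` ?J \<subseteq> A \<union> B" by (rule image_subsetI)
  moreover have "set P \<inter> (A \<union> B) = {}" using A_path_off_B[OF P True] P by (auto simp: A_path_def)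
  ultimately have "set P \<inter> cyc ` ?J = {}" by blast
  moreover have "v \<notin> set P" using A_path_off_B[OF P True] by (auto simp: B_def)
  moreover have "adj G v (cyc (2 * k - 2))" "adj G v (cyc (length C + (2 * j - 2)))"
    using cyc_even_mem_A[of "k - 1"] cyc_even_mem_A[of "j - 1"] j(1) k(2) \<open>j \<noteq> 0\<close>
    unfolding cyc_add_length(2) by (simp_all add: adj_v_iff diff_mult_distrib2)
  ultimately have "length P + (2 * k - 2) + (length C + (2 * j - 2)) + 3
      \<le> length C + (length C + 2 * j)"
    using P j v \<open>j \<noteq> 0\<close> k(2) length_C_cases by (intro reroute_predecessors) (auto simp: A_path_def)
  then show ?thesis using k(2) \<open>j \<noteq> 0\<close> by linarith
qed (use length_C_cases in auto)

lemma A_path_from_last_bound: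
  assumes P: "A_path (cyc (2 * k - 2)) P a'"
  shows "length P \<le> length C + 1 - 2 * k"
proof (cases "2 \<le> length P")
  case True
  obtain i where i: "i < k" "a' = cyc (2 * i)" using P A_cases by (auto simp: A_path_def)
  have "i \<noteq> k - 1" using P i(2) by (auto simp: A_path_def gpath_def diff_mult_distrib2)
  then have i': "2 * i + 2 \<le> 2 * k - 2" using i(1) by linarith
  let ?J = "{2 * i + 2..2 * k - 2} \<union> {length C..2 * i + length C}"
  have "cyc l \<in> A \<union> B" if "l \<in> ?J" for l
  proof (cases "length C \<le> l")
    case True
    then have "l - length C \<le> 2 * k - 2" using that i' length_C_cases by auto
    then show ?thesis
      using True cyc_mem_AB[of "l - length C"] cyc_add_length(1)[of "l - length C"] by simp
  qed (use that cyc_mem_AB in auto)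
  then have "cyc ` ?J \<subseteq> A \<union> B" by (rule image_subsetI)
  moreover have "set (rev P) \<inter> (A \<union> B) = {}"
    using A_path_off_B[OF P True] P by (auto simp: A_path_def)
  ultimately have "set (rev P) \<inter> cyc ` ?J = {}" by blast
  moreover have "v \<notin> set P" using A_path_off_B[OF P True] by (auto simp: B_def)
  moreover have "adj G v (cyc (2 * i + 2))" "adj G v (cyc (length C))"
    using cyc_even_mem_A[of "i + 1"] cyc_even_mem_A[of 0] i' k(2) by (simp_all add: adj_v_iff)
  ultimately have "length (rev P) + 2 * i + (2 * k - 2) + 3 \<le> 2 * i + 2 + length C"
    using A_path_rev[OF P] i i' v k(2) length_C_cases
    by (intro reroute_successors) (auto simp: A_path_def)
  then show ?thesis using k(2) by simp
qed (use length_C_cases in auto)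

lemma A_path_at_end_bound:
  assumes P: "A_path a P a'" and e: "a \<in> ends \<or> a' \<in> ends"
  shows "length P \<le> length C + 1 - 2 * k"
proof -
  have "C ! 0 = cyc 0" "C ! (2 * k - 2) = cyc (2 * k - 2)"
    using length_C length_C_cases k(2) by (auto simp: cyc_def)
  then have from_end: "length Q \<le> length C + 1 - 2 * k" if "A_path b Q b'" "b \<in> ends" for b Q b'
    using that A_path_from_first_bound A_path_from_last_bound by auto
  show ?thesis using e from_end[OF P] from_end[OF A_path_rev[OF P]] by auto
qed

lemma A_path_off_cycle:
  assumes P: "A_path a P a'" "set P \<inter> set C = {}" and long: "2 \<le> length P"
  shows "{a, a'} = ends"
proof -
  have increasing: "i = 0 \<and> j = k - 1"
    if Q: "A_path (cyc (2 * i)) Q (cyc (2 * j))" "set Q = set P" "length Q = length P"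
      and ij: "i < j" "j < k" for Q i j
  proof -
    have off: "set Q \<inter> cyc ` J = {}" "v \<notin> set Q" for J
      using Q(2) P(2) A_path_off_B[OF P(1) long] cyc_in_C by (auto simp: B_def)
    have A_even: "adj G v (cyc (2 * l))" if "l < k" for l
      using that cyc_even_mem_A by (simp add: adj_v_iff)
    have "j = k - 1"
    proof (rule ccontr)
      assume "j \<noteq> k - 1"
      then have "length Q + 2 * i + 2 * j + 3 \<le> 2 * (i + 1) + 2 * (j + 1)"
        using Q(1) off v ij A_even[of "i + 1"] A_even[of "j + 1"] length_C_cases
        by (intro reroute_successors) (auto simp: A_path_def)
      then show False using long Q(3) by simp
    qed
    moreover have "i = 0"
    proof (rule ccontr)
      assume "i \<noteq> 0"
      then have "length Q + 2 * (i - 1) + 2 * (j - 1) + 3 \<le> 2 * i + 2 * j"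
        using Q(1) off v ij A_even[of "i - 1"] A_even[of "j - 1"] length_C_cases
        by (intro reroute_predecessors) (auto simp: A_path_def)
      then show False using long Q(3) \<open>i \<noteq> 0\<close> ij(1) by simp
    qed
    ultimately show ?thesis by simp
  qed
  obtain i j where i: "i < k" "a = cyc (2 * i)" and j: "j < k" "a' = cyc (2 * j)"
    using P(1) A_cases unfolding A_path_def by metis
  have "i \<noteq> j" using P(1) i j by (auto simp: A_path_def gpath_def)
  then have "(i = 0 \<and> j = k - 1) \<or> (j = 0 \<and> i = k - 1)"
    using increasing[of i P j] increasing[of j "rev P" i] P(1) A_path_rev[OF P(1)] i j
    by (cases "i < j") auto
  moreover have "cyc 0 = C ! 0" "cyc (2 * (k - 1)) = C ! (2 * k - 2)"
    using length_C length_C_cases k(2) by (auto simp: cyc_def diff_mult_distrib2)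
  ultimately show ?thesis using i j by auto
qed

lemma edge_on_A_path:
  assumes z: "adj_off G A z z'"
  obtains p p' a a' where "A_path a (rev p @ p') a'" "p \<noteq> []" "p' \<noteq> []" "hd p = z" "hd p' = z'"
proof -
  have zz: "adj G z z'" "z \<in> verts G" "z' \<in> verts G" "z \<noteq> z'" "z \<notin> A" "z' \<notin> A"
    using z adj_verts[of z z'] by (auto simp: adj_off_def)
  have not_sub: "\<not> A \<subseteq> {u}" for u
    using card_A k(2) card_mono[of "{u}" A] by auto
  obtain q x where q: "gpath G (q @ [x])" "hd (q @ [x]) = z" "x \<in> A" "set q \<inter> A = {}"
      "z' \<notin> set (q @ [x])"
    using first_hit_avoiding[of z z' A] zz nbhd_verts not_sub by auto
  have P: "departs G {z, z'} (q @ [x])" "last (q @ [x]) \<in> A"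
    using q zz by (cases q; auto simp: departs_def gpath_def)+
  have Z: "z' \<in> {z, z'}" "z' \<noteq> hd (q @ [x])" "{z, z'} \<subseteq> verts G" "A \<inter> {z, z'} = {}"
    using q(2) zz by auto
  obtain p s p' t where p: "departs G {z, z'} (p @ [s])" "hd p = z" "p \<noteq> []" "s \<in> A"
      "set p \<inter> A = {}"
      and p': "departs G {z, z'} (p' @ [t])" "hd p' \<noteq> z" "p' \<noteq> []" "t \<in> A" "set p' \<inter> A = {}"
      and disjoint: "set (p @ [s]) \<inter> set (p' @ [t]) = {}"
    by (rule two_disjoint_paths[OF P Z(1-3) nbhd_verts Z(4) not_sub, unfolded q(2)])
  have "hd p' = z'" using p' by (simp add: departs_def)
  moreover have "gpath G (rev (p @ [s]) @ p' @ [t])"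
    using p p' disjoint zz(1) calculation gpath_rev[of G "p @ [s]"]
    by (subst gpath_append) (auto simp: departs_def last_rev simp del: rev_append)
  then have "A_path s (rev p @ p') t" using p p' by (auto simp: A_path_def)
  ultimately show thesis using that p(2,3) p'(3) by blast
qed

lemma adj_off_off_B:
  assumes "adj_off G A z z'"
  shows "z \<notin> B" and "z' \<notin> B"
proof -
  have "z' \<in> nbhd G z" "z \<in> nbhd G z'" "z \<notin> A" "z' \<notin> A"
    using assms by (simp_all add: adj_off_def mem_nbhd_iff adj_commute)
  then show "z \<notin> B" "z' \<notin> B" using nbhd_B_subset by blast+
qed

lemma no_edge_off_A_if_even:
  assumes "even (length C)"
  shows "\<not> adj_off G A z z'"
proof
  assume "adj_off G A z z'"
  then obtain p p' a a' where P: "A_path a (rev p @ p') a'" "p \<noteq> []" "p' \<noteq> []"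
    using edge_on_A_path by metis
  have long: "2 \<le> length (rev p @ p')" using P(2,3) by (cases p; cases p') auto
  have "set (rev p @ p') \<inter> set C = {}"
    using C_subset_AB_if_even[OF assms] A_path_off_B[OF P(1) long] P(1) by (auto simp: A_path_def)
  then have "{a, a'} = ends" using A_path_off_cycle P(1) long by blast
  then have "length (rev p @ p') \<le> length C + 1 - 2 * k" using A_path_at_end_bound[OF P(1)] by blast
  then show False using long assms k(1) by auto
qed

lemma embeds_in_W_graph_if_even:
  assumes "even (length C)"
  shows "iso_to_subgraph G (W_graph (card (verts G)) k (length C))"
proof -
  have "k + card ({} :: 'a set) \<le> length C - k + 1" using k(1) by simp
  then show ?thesis
    using embeds_in_W_graph[OF nbhd_verts card_A, of "{}"] no_edge_off_A_if_even[OF assms] by blast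
qed

end

section \<open>Cycles of odd length\<close>

locale odd_alternating_cycle = alternating_cycle +
  assumes odd: "odd (length C)"
begin

abbreviation x :: 'a where
  "x \<equiv> C ! (2 * k - 1)"

abbreviation y :: 'a where
  "y \<equiv> C ! (2 * k)"

lemma length_C_eq: "length C = 2 * k + 1"
  using odd k(1) by (auto elim: oddE)

lemma ends_subset_A: "ends \<subseteq> A"
  using cyc_even_mem_A[of 0] cyc_even_mem_A[of "k - 1"] length_C_eq k(2)
  by (simp add: cyc_nth diff_mult_distrib2)

lemma gap_edge: "adj_off G A x y" "adj G x (C ! (2 * k - 2))" "adj G y (C ! 0)"
proof -
  have "is_cycle G C" using longest by (simp add: longest_cycle_def)
  then have step: "adj G (C ! i) (C ! (Suc i mod length C))" if "i < length C" for i
    using that by (simp add: is_cycle_def adj_def)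
  have idx: "Suc (2 * k - 2) = 2 * k - 1" "Suc (2 * k - 1) = 2 * k" using k(2) by auto
  have "x \<notin> A" "y \<notin> A"
    using cyc_mem_A_iff[of "2 * k - 1"] cyc_mem_A_iff[of "2 * k"] length_C_eq k(2)
    by (auto simp: cyc_nth)
  then show "adj_off G A x y"
    using step[of "2 * k - 1"] length_C_eq k(2) idx by (simp add: adj_off_def)
  show "adj G x (C ! (2 * k - 2))" "adj G y (C ! 0)"
    using step[of "2 * k - 2"] step[of "2 * k"] length_C_eq k(2) idx by (simp_all add: adj_commute)
qed

lemma C_subset_AB_gap: "set C \<subseteq> A \<union> B \<union> {x, y}"
proof
  fix b assume "b \<in> set C"
  then obtain j where j: "j < length C" "b = cyc j" by (rule set_C_cases)
  then consider "j \<le> 2 * k - 2" | "j = 2 * k - 1" | "j = 2 * k" using length_C_eq by linarith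
  then show "b \<in> A \<union> B \<union> {x, y}"
    using j cyc_mem_AB[of j] by cases (auto simp: cyc_nth)
qed

lemma A_path_meeting_end_edge:
  assumes P: "A_path a P a'" "z \<in> set P" and z': "adj_off G A z z'"
    and e: "adj G z e" "adj G z' e'" "e \<in> ends" "e' \<in> ends"
  shows "length P \<le> 2"
proof (rule ccontr)
  assume long: "\<not> length P \<le> 2"
  have bound: "length Q \<le> 2" if "A_path b Q b'" "b \<in> ends \<or> b' \<in> ends" for b Q b'
    using A_path_at_end_bound[OF that] length_C_eq by simp
  have off: "e \<in> A" "e' \<in> A" "e \<noteq> a'" "e \<noteq> a" "e' \<noteq> a'" "e' \<noteq> a"
    using e(3,4) ends_subset_A bound[OF P(1)] long by auto
  obtain Q R where split: "P = Q @ z # R" using split_list[OF P(2)] by blast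
  have rev: "A_path a' (rev R @ z # rev Q) a" using A_path_rev[OF P(1)] split by simp
  have zR: "A_path e (z # R) a'" using A_path_shortcut P(1) off e(1) unfolding split by blast
  moreover have "A_path e (z # rev Q) a" using A_path_shortcut[OF rev] off e(1) by blast
  ultimately have "length R \<le> 1" "length Q \<le> 1" using bound e(3) by fastforce+
  then obtain q r where qr: "Q = [q]" "R = [r]" using long split by (cases Q; cases R) auto
  have "A_path e' [z', z, q] a \<or> A_path e' [z', z, r] a'"
  proof (cases "z' = r")
    case True
    then show ?thesis using A_path_shortcut[of a' "[]" r "[z, q]" a e'] rev qr off e(2) by simp
  next
    case False
    have "z' \<noteq> a'" "z' \<noteq> z" "adj G z' z" "z' \<in> verts G" "e' \<in> verts G" "e' \<noteq> z" "e' \<noteq> z'" "e' \<noteq> r"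
      using z' adj_verts[of z z'] adj_verts[OF e(2)] zR off qr
      by (auto simp: adj_off_def adj_commute A_path_def)
    then have "gpath G (e' # z' # z # r # [a'])"
      using zR qr off e(2) False by (simp add: A_path_def gpath_Cons adj_commute)
    then show ?thesis using zR qr z' off by (simp add: A_path_def adj_off_def)
  qed
  then show False using bound e(4) by fastforce
qed

lemma A_path_length_le:
  assumes P: "A_path a P a'"
  shows "length P \<le> 2"
proof (rule ccontr)
  assume long: "\<not> length P \<le> 2"
  have "adj_off G A y x" using gap_edge(1) adj_off_commute by metis
  then have "x \<notin> set P" "y \<notin> set P"
    using long A_path_meeting_end_edge[OF P] gap_edge by blast+
  moreover have "set P \<inter> (A \<union> B) = {}" using A_path_off_B[OF P] long P by (auto simp: A_path_def)
  ultimately have "set P \<inter> set C = {}" using C_subset_AB_gap by blast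
  then have "{a, a'} = ends" using A_path_off_cycle[OF P] long by simp
  then show False using A_path_at_end_bound[OF P] length_C_eq long by auto
qed

lemma adj_off_distinct_nbrs:
  assumes z: "adj_off G A z z'"
  obtains a a' where "a \<in> nbhd G z \<inter> A" "a' \<in> nbhd G z' \<inter> A" "a \<noteq> a'"
proof -
  obtain p p' a a' where p: "A_path a (rev p @ p') a'" "p \<noteq> []" "p' \<noteq> []" "hd p = z" "hd p' = z'"
    using edge_on_A_path[OF z] .
  have "length p + length p' \<le> 2" using A_path_length_le[OF p(1)] by simp
  then have "p = [z]" "p' = [z']" using p(2-5) by (cases p; cases p'; auto)+
  then show thesis
    using that[of a a'] p(1) by (auto simp: A_path_def gpath_Cons mem_nbhd_iff adj_commute)
qed

lemma common_nbr_of_path_ends: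
  assumes pqr: "adj_off G A p q" "adj_off G A q r" "p \<noteq> r"
  shows "\<exists>d. nbhd G p \<inter> A = {d} \<and> nbhd G r \<inter> A = {d}"
proof -
  have "gpath G [p, q, r]" "set [p, q, r] \<inter> A = {}"
    using pqr adj_verts[of p q] adj_verts[of q r] by (auto simp: adj_off_def gpath_Cons)
  then have same: "a = a'" if "a \<in> nbhd G p \<inter> A" "a' \<in> nbhd G r \<inter> A" for a a'
    using A_path_of_gpath[of "[p, q, r]" a a'] A_path_length_le[of a "[p, q, r]" a'] that by auto
  obtain d where d: "d \<in> nbhd G p \<inter> A" using adj_off_distinct_nbrs[OF pqr(1)] by metis
  obtain d' where d': "d' \<in> nbhd G r \<inter> A" using adj_off_distinct_nbrs[OF pqr(2)] by metis
  have "nbhd G p \<inter> A = {d}" "nbhd G r \<inter> A = {d}" using same d d' by blast+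
  then show ?thesis by blast
qed

lemma walk_off_A_turns:
  assumes pqrt: "adj_off G A p q" "adj_off G A q r" "adj_off G A r t"
  shows "p = r \<or> q = t"
proof (rule ccontr)
  assume "\<not> ?thesis"
  then have ne: "p \<noteq> r" "q \<noteq> t" by auto
  obtain d where d: "nbhd G p \<inter> A = {d}" "nbhd G r \<inter> A = {d}"
    using common_nbr_of_path_ends[OF pqrt(1,2) ne(1)] by blast
  obtain d' where d': "nbhd G q \<inter> A = {d'}" "nbhd G t \<inter> A = {d'}"
    using common_nbr_of_path_ends[OF pqrt(2,3) ne(2)] by blast
  have "d \<noteq> d'" using adj_off_distinct_nbrs[OF pqrt(1)] d(1) d'(1) by (metis singletonD)
  moreover from this have "p \<noteq> t" using d(1) d'(2) by auto
  then have "gpath G [p, q, r, t]" "set [p, q, r, t] \<inter> A = {}"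
    using pqrt ne adj_verts[of p q] adj_verts[of q r] adj_verts[of r t]
    by (auto simp: adj_off_def gpath_Cons)
  ultimately have "A_path d [p, q, r, t] d'"
    using A_path_of_gpath[of "[p, q, r, t]" d d'] d(1) d'(2) by simp
  then show False using A_path_length_le by fastforce
qed

lemma nbrs_eq_ends_off_gap:
  assumes z: "adj_off G A z z'" "{z, z'} \<inter> {x, y} = {}"
    and a: "a \<in> nbhd G z \<inter> A" "a' \<in> nbhd G z' \<inter> A" "a \<noteq> a'"
  shows "{a, a'} = ends"
proof -
  have "z \<notin> A \<union> B" "z' \<notin> A \<union> B" using z(1) adj_off_off_B[OF z(1)] by (auto simp: adj_off_def)
  then have "set [z, z'] \<inter> set C = {}" using C_subset_AB_gap z(2) by auto
  moreover have "gpath G [z, z']" "set [z, z'] \<inter> A = {}"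
    using z(1) adj_verts[of z z'] by (auto simp: adj_off_def gpath_Cons)
  then have "A_path a [z, z'] a'" using A_path_of_gpath[of "[z, z']" a a'] a by simp
  ultimately show ?thesis using A_path_off_cycle by simp
qed

lemma edge_off_gap_nbrs:
  assumes z: "adj_off G A z z'" "{z, z'} \<inter> {x, y} = {}"
  shows "(nbhd G z \<union> nbhd G z') \<inter> A = ends"
proof -
  note ends_eq = nbrs_eq_ends_off_gap[OF z]
  obtain a a' where a: "a \<in> nbhd G z \<inter> A" "a' \<in> nbhd G z' \<inter> A" "a \<noteq> a'"
    using adj_off_distinct_nbrs[OF z(1)] .
  have "d \<in> ends" if d: "d \<in> (nbhd G z \<union> nbhd G z') \<inter> A" for d
  proof -
    consider (at_z) "d \<in> nbhd G z \<inter> A" | (at_z') "d \<in> nbhd G z' \<inter> A" using d by blast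
    then show ?thesis
    proof cases
      case at_z
      then show ?thesis using ends_eq[OF at_z a(2)] ends_eq[OF a] by (cases "d = a'") auto
    next
      case at_z'
      then show ?thesis using ends_eq[OF a(1) at_z'] ends_eq[OF a] by (cases "d = a") auto
    qed
  qed
  moreover have "{a, a'} \<subseteq> (nbhd G z \<union> nbhd G z') \<inter> A" using a by blast
  ultimately show ?thesis using ends_eq[OF a] by blast
qed

lemma swap_gap_edge:
  assumes x'y': "adj_off G A x' y'" "adj G x' (C ! (2 * k - 2))" "adj G y' (C ! 0)"
  obtains C' where "odd_alternating_cycle G C' k v" "C' ! 0 = C ! 0"
    "C' ! (2 * k - 2) = C ! (2 * k - 2)"
    "C' ! (2 * k - 1) = x'" "C' ! (2 * k) = y'"
proof -
  let ?S = "take (2 * k - 1) C"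
  let ?C = "?S @ [x', y']"
  have len: "length ?S = 2 * k - 1" "length ?C = length C" using length_C_eq k(2) by auto
  then have "?S \<noteq> []" using k(2) by auto
  then have S: "gpath G ?S" using gpath_appendD(1)[of G ?S "drop (2 * k - 1) C"] gpath_C by simp
  have S_AB: "set ?S \<subseteq> A \<union> B"
  proof
    fix b assume "b \<in> set ?S"
    then obtain i where "i < 2 * k - 1" "b = C ! i" by (auto simp: in_set_conv_nth)
    then show "b \<in> A \<union> B" using cyc_mem_AB[of i] length_C_eq by (simp add: cyc_nth)
  qed
  have off: "x' \<notin> A \<union> B" "y' \<notin> A \<union> B"
    using x'y'(1) adj_off_off_B[OF x'y'(1)] by (auto simp: adj_off_def)
  have ends_S: "last ?S = C ! (2 * k - 2)" "hd ?S = C ! 0"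
    using \<open>?S \<noteq> []\<close> len length_C_eq k(2) by (simp_all add: last_conv_nth hd_conv_nth numeral_2_eq_2)
  have "gpath G [x', y']"
    using x'y'(1) adj_verts[of x' y'] by (simp add: gpath_Cons adj_off_def)
  then have "gpath G ?C"
    using S \<open>?S \<noteq> []\<close> ends_S(1) x'y'(2) S_AB off by (subst gpath_append) (auto simp: adj_commute)
  then have "is_cycle G ?C"
    using ends_S(2) \<open>?S \<noteq> []\<close> x'y'(3) length_C len(2) by (simp add: is_cycle_iff)
  then have "longest_cycle G ?C" using longest unfolding longest_cycle_def len(2) by blast
  moreover have "v \<notin> set ?C"
    using v(2) off in_set_takeD[of v "2 * k - 1" C] by (auto simp: B_def)
  moreover have "A = (\<lambda>i. ?C ! (2 * i)) ` {..<k}"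
    unfolding nbhd_v using len(1) by (intro image_cong) (auto simp: nth_append)
  ultimately have "odd_alternating_cycle G ?C k v"
    using odd k v(1) len(2) by unfold_locales simp_all
  moreover have "?C ! 0 = C ! 0" "?C ! (2 * k - 2) = C ! (2 * k - 2)" "?C ! (2 * k - 1) = x'"
      "?C ! (2 * k) = y'"
    unfolding nth_append len(1) using k(2) by auto
  ultimately show thesis by (rule that)
qed

lemma attached_star_forest_if_edge_off_gap:
  assumes z: "adj_off G A z z'" "{z, z'} \<inter> {x, y} = {}"
  shows "attached_star_forest G A (C ! 0) (C ! (2 * k - 2))"
proof -
  obtain a a' where a: "a \<in> nbhd G z \<inter> A" "a' \<in> nbhd G z' \<inter> A" "a \<noteq> a'"
    using adj_off_distinct_nbrs[OF z(1)] .
  then have "{a, a'} = ends" by (rule nbrs_eq_ends_off_gap[OF z])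
  then have "adj G z (C ! (2 * k - 2)) \<and> adj G z' (C ! 0) \<or>
      adj G z' (C ! (2 * k - 2)) \<and> adj G z (C ! 0)"
    using a by (auto simp: doubleton_eq_iff mem_nbhd_iff adj_commute)
  then obtain x' y' where x'y': "{x', y'} = {z, z'}" "adj G x' (C ! (2 * k - 2))" "adj G y' (C ! 0)"
    by (metis insert_commute)
  have edge: "adj_off G A x' y'" "{x', y'} \<inter> {x, y} = {}"
    using x'y'(1) z adj_off_commute[of G A z z'] by (auto simp: doubleton_eq_iff)
  obtain C' where C': "odd_alternating_cycle G C' k v" "C' ! 0 = C ! 0"
      "C' ! (2 * k - 2) = C ! (2 * k - 2)"
      "C' ! (2 * k - 1) = x'" "C' ! (2 * k) = y'"
    using swap_gap_edge[OF edge(1) x'y'(2,3)] .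
  have swapped: "(nbhd G u \<union> nbhd G u') \<inter> A = ends" if "adj_off G A u u'"
      "{u, u'} \<inter> {x', y'} = {}" for u u'
    using odd_alternating_cycle.edge_off_gap_nbrs[OF C'(1) that(1)] that(2) C'(2-5) by simp
  have no_bridge: "\<not> adj_off G A u u'" if u: "u \<in> {x, y}" "u' \<in> {x', y'}" for u u'
  proof
    assume uu': "adj_off G A u u'"
    obtain s where s: "adj_off G A s u" "s \<in> {x, y}"
      using u(1) gap_edge(1) adj_off_commute by (metis insertE insertI1 insertI2 singletonD)
    obtain s' where s': "adj_off G A u' s'" "s' \<in> {x', y'}"
      using u(2) edge(1) adj_off_commute by (metis insertE insertI1 insertI2 singletonD)
    have "s = u' \<or> u = s'" using walk_off_A_turns[OF s(1) uu' s'(1)] .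
    then show False using edge(2) u s(2) s'(2) by blast
  qed
  show ?thesis
  proof unfold_locales
    show "A \<subseteq> verts G" "C ! 0 \<in> A" "C ! (2 * k - 2) \<in> A" using nbhd_verts ends_subset_A by auto
    show "\<exists>p q r t. adj_off G A p q \<and> adj_off G A r t \<and> {p, q} \<inter> {r, t} = {}"
      using gap_edge(1) edge by blast
    fix u u' assume u: "adj_off G A u u'"
    then have "{u, u'} \<inter> {x, y} = {} \<or> {u, u'} \<inter> {x', y'} = {}"
      using no_bridge[of u u'] no_bridge[of u' u] edge(2) adj_off_commute[of G A u u'] by auto
    then show "(nbhd G u \<union> nbhd G u') \<inter> A = ends"
      using edge_off_gap_nbrs[OF u] swapped[OF u] by blast
  qed (use walk_off_A_turns common_nbr_of_path_ends in blast)+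
qed

lemma attached_star_if_all_edges_meet_gap:
  assumes meet: "\<And>u u'. adj_off G A u u' \<Longrightarrow> {u, u'} \<inter> {x, y} \<noteq> {}"
    and cd: "{c, d} = {x, y}" and z: "adj_off G A c z" "z \<noteq> d"
  shows "\<exists>w. attached_star G A c w"
proof -
  have edge: "adj_off G A c d" "adj_off G A d c" "adj_off G A z c"
    using cd gap_edge(1) z(1) adj_off_commute by (metis doubleton_eq_iff)+
  have centre: "u = c \<or> u' = c" if u: "adj_off G A u u'" for u u'
  proof (rule ccontr)
    assume no_c: "\<not> ?thesis"
    then have "d \<in> {u, u'}" using meet[OF u] cd by auto
    then obtain t where t: "adj_off G A d t" "t \<noteq> c"
      using u no_c adj_off_commute by (metis insertE singletonD)
    show False using walk_off_A_turns[OF edge(3,1) t(1)] z(2) t(2) by blast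
  qed
  obtain w where w: "nbhd G d \<inter> A = {w}" "nbhd G z \<inter> A = {w}"
    using common_nbr_of_path_ends[OF edge(2) z(1)] z(2) by blast
  have leaf: "nbhd G l = {w, c}" if l: "adj_off G A c l" for l
  proof -
    have "nbhd G l \<inter> A = {w}"
      using common_nbr_of_path_ends[OF edge(2) l] w by (cases "l = d") auto
    moreover have "nbhd G l - A \<subseteq> {c}"
    proof
      fix b assume "b \<in> nbhd G l - A"
      then have lb: "adj_off G A l b" using l by (simp add: adj_off_def mem_nbhd_iff adj_commute)
      then show "b \<in> {c}" using centre[OF lb] l by (auto simp: adj_off_def)
    qed
    moreover have "c \<in> nbhd G l" using l by (simp add: adj_off_def mem_nbhd_iff)
    ultimately show ?thesis by blast
  qed
  have "w \<in> A" using w(1) by blast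
  moreover have "c \<in> verts G - A" using edge(1) adj_verts(1) by (auto simp: adj_off_def)
  ultimately have "attached_star G A c w"
    using nbhd_verts centre leaf by unfold_locales
  then show ?thesis ..
qed

lemma structure_off_A:
  "(\<forall>u u'. adj_off G A u u' \<longrightarrow> {u, u'} = {x, y}) \<or> (\<exists>z w. attached_star G A z w) \<or>
    attached_star_forest G A (C ! 0) (C ! (2 * k - 2))"
proof (cases "\<exists>u u'. adj_off G A u u' \<and> {u, u'} \<inter> {x, y} = {}")
  case True
  then show ?thesis using attached_star_forest_if_edge_off_gap by blast
next
  case False
  then have meet: "{u, u'} \<inter> {x, y} \<noteq> {}" if "adj_off G A u u'" for u u' using that by blast
  have star: "\<exists>z w. attached_star G A z w" if "adj_off G A s t" "s \<in> {x, y}"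
      "{s, t} \<noteq> {x, y}" for s t
  proof (cases "s = x")
    case True
    then show ?thesis using attached_star_if_all_edges_meet_gap[OF meet, of x y t] that by blast
  next
    case False
    then have "s = y" using that(2) by blast
    then show ?thesis
      using attached_star_if_all_edges_meet_gap[OF meet, of y x t] that(1,3)
      by (auto simp: insert_commute)
  qed
  have "\<exists>z w. attached_star G A z w" if u: "adj_off G A u u'" "{u, u'} \<noteq> {x, y}" for u u'
  proof (cases "u \<in> {x, y}")
    case True
    then show ?thesis using star u by blast
  next
    case False
    then have "u' \<in> {x, y}" using meet[OF u(1)] by auto
    moreover have "adj_off G A u' u" "{u', u} \<noteq> {x, y}"
      using u adj_off_commute[of G A u u'] by (auto simp: insert_commute)
    ultimately show ?thesis using star by blast
  qed
  then show ?thesis by blast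
qed

lemma embeds_in_family:
  "iso_to_subgraph G (W_graph (card (verts G)) k (length C)) \<or>
   (\<exists>H :: nat sgraph. H \<in> X_family (card (verts G)) (length C) \<union>
      Y_family (card (verts G)) (length C) \<and> iso_to_subgraph G H)"
proof -
  have card: "card A = length C div 2" using card_A k(1) by simp
  consider (one_edge) "\<forall>u u'. adj_off G A u u' \<longrightarrow> {u, u'} = {x, y}"
    | (star) z w where "attached_star G A z w"
    | (forest) "attached_star_forest G A (C ! 0) (C ! (2 * k - 2))"
    using structure_off_A by blast
  then show ?thesis
  proof cases
    case one_edge
    have "{x, y} \<subseteq> verts G - A" "x \<noteq> y"
      using gap_edge(1) adj_verts[of x y] by (auto simp: adj_off_def)
    moreover from this have "k + card {x, y} \<le> length C - k + 1" using length_C_eq by simp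
    moreover have "u \<in> {x, y} \<and> u' \<in> {x, y}" if "adj_off G A u u'" for u u'
      using one_edge that by blast
    ultimately show ?thesis using embeds_in_W_graph[OF nbhd_verts card_A, of "{x, y}"] by blast
  next
    case star
    then show ?thesis using attached_star.embeds_in_X_family[OF star card] by blast
  next
    case forest
    then show ?thesis using attached_star_forest.embeds_in_Y_family[OF forest card] by blast
  qed
qed

end

theorem theorem1p11:
  fixes G :: "'a sgraph" and C :: "'a list" and n c :: nat
  assumes "simple_graph G"
    and "card (verts G) = n"
    and "k_connected 2 G"
    and "longest_cycle G C"
    and "length C = c"
    and "10 \<le> c" and "c \<le> n - 1"
    and "card {e \<in> edges G. card (e \<inter> set C) \<le> 1} > (c div 2 - 1) * (n - c)"
  shows "iso_to_subgraph G (W_graph n (c div 2) c) \<or>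
         odd c \<and> (\<exists>H :: nat sgraph. H \<in> X_family n c \<union> Y_family n c \<and> iso_to_subgraph G H)"
proof -
  interpret longest_cycle_graph G C
    using assms(1,3,4) by unfold_locales
  have "card (verts G - set C) = n - c"
    using C_verts distinct_C assms(2,5) by (simp add: card_Diff_subset distinct_card)
  then obtain v where "v \<in> verts G" "v \<notin> set C" "nbhd G v \<subseteq> set C" "card (nbhd G v) = c div 2"
    using exists_half_vertex assms(5,6,8) by auto
  moreover have "2 \<le> c div 2" using assms(6) by linarith
  ultimately obtain C' where C': "alternating_cycle G C' (c div 2) v" "length C' = c"
    using exists_alternating_rotation[of "c div 2" v] assms(5) by metis
  show ?thesis
  proof (cases "even c")
    case True
    then show ?thesis
      using alternating_cycle.embeds_in_W_graph_if_even[OF C'(1)] C'(2) assms(2) by simp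
  next
    case False
    then have "odd_alternating_cycle G C' (c div 2) v"
      using C' by (simp add: odd_alternating_cycle_def odd_alternating_cycle_axioms_def)
    from odd_alternating_cycle.embeds_in_family[OF this] show ?thesis
      using C'(2) assms(2) False by simp
  qed
qed

end
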